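(* There exists an absolute constant $c$ such that for every $n\ge 1$, every generalized Orlicz ball $K\subset\mathbb{R}^n$ of volume $1$ in isotropic position, and every $\theta\in S^{n-1}$, $$\sup_{t\in\mathbb{R}}\bigg|\int_{-\infty}^t\big(g_\theta(s)-g(s)\big)\,ds\bigg|\le c\,\|\theta\|_3^{3/2},$$ where $g_\theta$ is the density of the random variable $\langle X,\theta\rangle$ with $X$ uniformly distributed on $K$, and $g$ is the density of the normal distribution $\mathcal{N}(0,L_K^2)$ with mean $0$ and variance $L_K^2$.
   Context: A generalized Orlicz ball in $\mathbb{R}^n$ is a set of the form $K=\{x\in\mathbb{R}^n:\sum_{i=1}^n f_i(|x_i|)\le 1\}$, where $f_1,\dots,f_n:[0,\infty)\to[0,\infty)$ (the Young functions) are convex, (strictly) increasing and satisfy $f_i(0)=0$. $K$ of volume $1$ is in isotropic position if, for $X=(X_1,\dots,X_n)$ uniformly distributed on $K$, $\mathbb{E}X_i=0$ and $\mathbb{E}X_iX_j=L_K^2\delta_{ij}$ for all $i,j$, for some constant $L_K>0$; this defines $L_K$. $S^{n-1}$ is the Euclidean unit sphere, $\langle\cdot,\cdot\rangle$ the standard inner product, and $\|\theta\|_3=(\sum_{i=1}^n|\theta_i|^3)^{1/3}$. *)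

theory Defs
  imports "HOL-Probability.Probability"
begin

text \<open>
  The constant in the theorem must not depend on the dimension, so the dimension cannot be a
  type. The space \<open>\<real>\<^sup>n\<close> is rendered as \<^term>\<open>space (euclidean_lborel n)\<close>, the functions
  \<^typ>\<open>nat \<Rightarrow> real\<close> that are \<^term>\<open>undefined\<close> outside \<^term>\<open>{..<n}\<close>. Directions are arbitrary
  functions of which only the first \<open>n\<close> coordinates are used.
\<close>

definition euclidean_lborel :: "nat \<Rightarrow> (nat \<Rightarrow> real) measure"
  where "euclidean_lborel n = (\<Pi>\<^sub>M i\<in>{..<n}. lborel)"

definition inner_n :: "nat \<Rightarrow> (nat \<Rightarrow> real) \<Rightarrow> (nat \<Rightarrow> real) \<Rightarrow> real"
  where "inner_n n x y = (\<Sum>i<n. x i * y i)"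

definition unit_sphere_n :: "nat \<Rightarrow> (nat \<Rightarrow> real) set"
  where "unit_sphere_n n = {\<theta>. sqrt (inner_n n \<theta> \<theta>) = 1}"

definition norm3_n :: "nat \<Rightarrow> (nat \<Rightarrow> real) \<Rightarrow> real"
  where "norm3_n n \<theta> = (\<Sum>i<n. \<bar>\<theta> i\<bar> ^ 3) powr (1 / 3)"

text \<open>Only the values on \<open>[0,\<infinity>)\<close> matter.\<close>

definition young_function :: "(real \<Rightarrow> real) \<Rightarrow> bool"
  where "young_function f \<longleftrightarrow>
    f ` {0..} \<subseteq> {0..} \<and> convex_on {0..} f \<and> strict_mono_on {0..} f \<and> f 0 = 0"

definition generalized_orlicz_ball :: "nat \<Rightarrow> (nat \<Rightarrow> real) set \<Rightarrow> bool"
  where "generalized_orlicz_ball n K \<longleftrightarrow>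
    (\<exists>f. (\<forall>i<n. young_function (f i)) \<and>
         K = {x \<in> space (euclidean_lborel n). (\<Sum>i<n. f i \<bar>x i\<bar>) \<le> 1})"

definition uniform_on :: "nat \<Rightarrow> (nat \<Rightarrow> real) set \<Rightarrow> (nat \<Rightarrow> real) measure"
  where "uniform_on n K = uniform_measure (euclidean_lborel n) K"

text \<open>
  \<open>isotropic_position n K L\<close>: \<open>K\<close> has volume 1 and is in isotropic position with \<open>L\<^sub>K = L\<close>, which
  is determined by \<open>K\<close> when \<open>n \<ge> 1\<close>. Integrability needs no separate clause: since \<open>L > 0\<close>,
  the diagonal conditions exclude the default value 0 of a divergent integral, so all
  coordinates are square integrable.
\<close>

definition isotropic_position :: "nat \<Rightarrow> (nat \<Rightarrow> real) set \<Rightarrow> real \<Rightarrow> bool"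
  where "isotropic_position n K L \<longleftrightarrow>
    emeasure (euclidean_lborel n) K = 1 \<and> L > 0 \<and>
    (\<forall>i<n. (LINT x|uniform_on n K. x i) = 0) \<and>
    (\<forall>i<n. \<forall>j<n. (LINT x|uniform_on n K. x i * x j) = (if i = j then L\<^sup>2 else 0))"

text \<open>
  Densities are determined only almost everywhere; this predicate holds for every nonnegative
  real-valued version of the density of \<open>\<langle>X, \<theta>\<rangle>\<close>, where \<open>X\<close> is uniformly distributed on \<open>K\<close>.
\<close>

definition is_marginal_density ::
    "nat \<Rightarrow> (nat \<Rightarrow> real) set \<Rightarrow> (nat \<Rightarrow> real) \<Rightarrow> (real \<Rightarrow> real) \<Rightarrow> bool"
  where "is_marginal_density n K \<theta> g\<theta> \<longleftrightarrow>
    (\<forall>s. g\<theta> s \<ge> 0) \<and>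
    distributed (uniform_on n K) lborel (\<lambda>x. inner_n n x \<theta>) (\<lambda>s. ennreal (g\<theta> s))"

end

theory Submission
  imports Defs
begin

text \<open>
  Let \<open>X\<close> be uniform on \<open>K\<close>, put \<open>a\<^sub>i = \<theta>\<^sub>i X\<^sub>i / L\<close>, let \<open>W\<close> be the sum of the \<open>a\<^sub>i\<close>, and write \<open>\<beta>\<close>
  for the sum of the \<open>\<bar>\<theta>\<^sub>i\<bar>\<^sup>3\<close>, so that the claim is a bound of order \<open>sqrt \<beta>\<close> for the Kolmogorov
  distance between \<open>W\<close> and a standard normal variable \<open>Z\<close>. The proof combines Stein's method with
  two facts about the coordinates of \<open>X\<close>.

  \<^bold>\<open>Stein's method.\<close> Reflecting one coordinate preserves the law of \<open>X\<close>. Hence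
  \<open>E (a\<^sub>i f(W)) = E (a\<^sub>i (f(W) - f(W - 2 a\<^sub>i))) / 2\<close>, and the right-hand side is \<open>E (a\<^sub>i\<^sup>2 f'(W))\<close> up to
  a term of third order in \<open>a\<^sub>i\<close>. If \<open>f\<close> solves \<open>f'(x) - x f(x) = h(x) - E h(Z)\<close>, summation over
  \<open>i\<close> shows that \<open>E h(W) - E h(Z)\<close> is \<open>E ((1 - V) f'(W))\<close> up to third-order terms, where \<open>V\<close> is the
  sum of the \<open>a\<^sub>i\<^sup>2\<close>. For a test function \<open>h\<close> that descends from 1 to 0 over an interval of length
  \<open>d\<close>, the third-order terms are of order \<open>\<beta> (1 + 1 / d)\<close> as soon as sixth moments of \<open>X\<^sub>i / L\<close> are
  bounded (\<open>stein_discrepancy\<close>). Replacing the indicator of a half-line by such an \<open>h\<close> costs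
  a further \<open>d\<close>, and \<open>d = sqrt \<beta>\<close> balances the two costs; this choice is the source of the exponent \<open>3/2\<close>. The term with
  \<open>1 - V\<close> is bounded by the standard deviation of \<open>V\<close>; if the squares of the coordinates
  are negatively correlated, the variance of \<open>V\<close> is at most the sum of the
  \<open>\<theta>\<^sub>i\<^sup>4 E (X\<^sub>i / L)\<^sup>4\<close>, again of order \<open>\<beta>\<close>.

  \<^bold>\<open>Log-concavity.\<close> Sixth moments and negative correlation both come from one fact: the volume of
  \<open>{x. f\<^sub>1(\<bar>x\<^sub>1\<bar>) + \<dots> + f\<^sub>n(\<bar>x\<^sub>n\<bar>) \<le> s}\<close> is log-concave in the level \<open>s\<close>. The proof goes by
  induction on the number of coordinates, slicing in one coordinate and applying the
  Prekopa--Leindler inequality on the half-line. Only decreasing functions occur there, whose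
  superlevel sets are intervals starting at 0, so the inequality follows from integrating over levels
  (\<open>prekopa_leindler_antimono\<close>). The same argument shows that the tail of \<open>\<bar>X\<^sub>i\<bar>\<close> is log-concave,
  hence geometric on the scale \<open>L\<close> (\<open>orlicz_tail_geometric\<close>), which bounds all moments by powers of
  \<open>L\<close>. Finally the joint density of two coordinates is \<open>\<psi>(f\<^sub>i(\<bar>y\<bar>) + f\<^sub>j(\<bar>z\<bar>))\<close> with \<open>\<psi>\<close> log-concave;
  since \<open>f\<^sub>i\<close> and \<open>f\<^sub>j\<close> are increasing, such a density is reverse totally positive in \<open>(\<bar>y\<bar>, \<bar>z\<bar>)\<close>, and two applications of Chebyshev's
  integral inequality show that the squares are negatively correlated
  (\<open>orlicz_square_negative_correlation\<close>).

  The density of \<open>\<langle>X, \<theta>\<rangle>\<close> exists by the Radon--Nikodym theorem, because preimages of null sets under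
  a nonzero linear form are null sets.
\<close>

section \<open>The Prekopa--Leindler inequality for decreasing functions\<close>

text \<open>
  The one-dimensional Brunn--Minkowski inequality for intervals \<open>[0, a)\<close> and \<open>[0, b)\<close>, in the form
  in which level sets of decreasing functions supply it: if \<open>C\<close> contains the combination of any two
  points, then it contains the initial interval up to the combination of the two lengths.
\<close>

lemma interval_combination_measure:
  fixes A B C :: "real set" and \<kappa> :: real
  assumes l: "0 < \<kappa>" "\<kappa> < 1"
    and A: "A \<subseteq> {0..}" "0 \<in> A" "\<And>x y. 0 \<le> x \<Longrightarrow> x \<le> y \<Longrightarrow> y \<in> A \<Longrightarrow> x \<in> A"
    and B: "B \<subseteq> {0..}" "0 \<in> B" "\<And>x y. 0 \<le> x \<Longrightarrow> x \<le> y \<Longrightarrow> y \<in> B \<Longrightarrow> x \<in> B"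
    and comb: "\<And>x y. x \<in> A \<Longrightarrow> y \<in> B \<Longrightarrow> \<kappa> * x + (1 - \<kappa>) * y \<in> C"
    and C: "C \<in> sets borel"
  shows "\<kappa> * emeasure lborel A + (1 - \<kappa>) * emeasure lborel B \<le> emeasure lborel C"
proof (cases "emeasure lborel C = \<infinity>")
  case False
  define m where "m = measure lborel C"
  have mC: "emeasure lborel C = ennreal m"
    using False unfolding m_def by (simp add: emeasure_eq_ennreal_measure)
  have m: "\<kappa> * p + (1 - \<kappa>) * q \<le> m" if p: "p \<in> A" and q: "q \<in> B" for p q
  proof -
    have p0: "0 \<le> p" and q0: "0 \<le> q" using p q A B by auto
    define r where "r = \<kappa> * p + (1 - \<kappa>) * q"
    have r0: "0 \<le> r" using p0 q0 l by (simp add: r_def)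
    have "{0..r} \<subseteq> C"
    proof
      fix x assume x: "x \<in> {0..r}"
      show "x \<in> C"
      proof (cases "r = 0")
        case True
        then show ?thesis using comb[OF A(2) B(2)] x by simp
      next
        case False
        define s where "s = x / r"
        have s: "0 \<le> s" "s \<le> 1" using x False r0 by (auto simp: s_def)
        have "s * p \<in> A" using A(3)[of "s * p" p] s p0 p by (simp add: mult_left_le_one_le)
        moreover have "s * q \<in> B" using B(3)[of "s * q" q] s q0 q by (simp add: mult_left_le_one_le)
        ultimately have "\<kappa> * (s * p) + (1 - \<kappa>) * (s * q) \<in> C" by (rule comb)
        moreover have "\<kappa> * (s * p) + (1 - \<kappa>) * (s * q) = s * r" by (simp add: r_def algebra_simps)
        moreover have "s * r = x" using False by (simp add: s_def)
        ultimately show ?thesis by simp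
      qed
    qed
    then have "emeasure lborel {0..r} \<le> emeasure lborel C" using C by (intro emeasure_mono) auto
    then show ?thesis using r0 mC by (simp add: r_def m_def)
  qed
  define a where "a = Sup A"
  define b where "b = Sup B"
  have bA: "bdd_above A" using m[OF _ B(2)] l
    by (intro bdd_aboveI[of _ "m / \<kappa>"]) (simp add: field_simps)
  have bB: "bdd_above B" using m[OF A(2)] l
    by (intro bdd_aboveI[of _ "m / (1 - \<kappa>)"]) (simp add: field_simps)
  have b1: "b \<le> (m - \<kappa> * p) / (1 - \<kappa>)" if "p \<in> A" for p
    unfolding b_def using m[OF that] l B by (intro cSup_least) (auto simp: field_simps)
  have "a \<le> (m - (1 - \<kappa>) * b) / \<kappa>"
    unfolding a_def using b1 l A by (intro cSup_least) (auto simp: field_simps)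
  then have ab: "\<kappa> * a + (1 - \<kappa>) * b \<le> m" using l by (simp add: field_simps)
  have a0: "0 \<le> a" "0 \<le> b" unfolding a_def b_def using cSup_upper[OF A(2) bA] cSup_upper[OF B(2) bB] by auto
  have "emeasure lborel A \<le> emeasure lborel {0..a}"
    using A bA by (intro emeasure_mono) (auto simp: a_def intro: cSup_upper)
  then have eA: "emeasure lborel A \<le> ennreal a" using a0 by simp
  have "emeasure lborel B \<le> emeasure lborel {0..b}"
    using B bB by (intro emeasure_mono) (auto simp: b_def intro: cSup_upper)
  then have eB: "emeasure lborel B \<le> ennreal b" using a0 by simp
  have "\<kappa> * emeasure lborel A + (1 - \<kappa>) * emeasure lborel B \<le> ennreal \<kappa> * ennreal a + ennreal (1 - \<kappa>) * ennreal b"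
    using eA eB by (intro add_mono mult_left_mono) auto
  also have "\<dots> = ennreal (\<kappa> * a + (1 - \<kappa>) * b)"
    using l a0 by (simp add: ennreal_mult' ennreal_plus)
  also have "\<dots> \<le> emeasure lborel C" using ab mC by (simp add: ennreal_leI)
  finally show ?thesis .
qed simp

text \<open>
  Integrating the lengths of the superlevel sets only over levels below 1 yields the integral of
  \<open>min 1 v\<close>. This is the full integral when \<open>v \<le> 1\<close> and a lower bound for it in general, which is
  all that is needed of the function on the larger side of the inequality below.
\<close>

lemma truncated_layer_cake:
  fixes v :: "real \<Rightarrow> real"
  assumes [measurable]: "v \<in> borel_measurable borel" and v0: "\<And>x. 0 \<le> v x"
  shows "(\<integral>\<^sup>+ t. indicator {0<..<1} t * emeasure lborel {x. 0 \<le> x \<and> t < v x} \<partial>lborel)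
       = (\<integral>\<^sup>+ x. ennreal (min 1 (v x)) * indicator {0..} x \<partial>lborel)"
proof -
  have "(\<integral>\<^sup>+ t. indicator {0<..<1} t * emeasure lborel {x. 0 \<le> x \<and> t < v x} \<partial>lborel)
      = (\<integral>\<^sup>+ t. (\<integral>\<^sup>+ x. indicator {0<..<1} t * indicator {x. 0 \<le> x \<and> t < v x} x \<partial>lborel) \<partial>lborel)"
    by (intro nn_integral_cong) (simp add: nn_integral_cmult)
  also have "\<dots> = (\<integral>\<^sup>+ t. (\<integral>\<^sup>+ x. indicator {(t,x). 0 < t \<and> t < 1 \<and> 0 \<le> x \<and> t < v x} (t,x) \<partial>lborel) \<partial>lborel)"
    by (intro nn_integral_cong) (auto simp: indicator_def)
  also have "\<dots> = (\<integral>\<^sup>+ x. (\<integral>\<^sup>+ t. indicator {(t,x). 0 < t \<and> t < 1 \<and> 0 \<le> x \<and> t < v x} (t,x) \<partial>lborel) \<partial>lborel)"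
    by (intro lborel_pair.Fubini'[symmetric]) (simp add: case_prod_beta)
  also have "\<dots> = (\<integral>\<^sup>+ x. ennreal (min 1 (v x)) * indicator {0..} x \<partial>lborel)"
  proof (intro nn_integral_cong)
    fix x :: real
    have "(\<integral>\<^sup>+ t. indicator {(t,x). 0 < t \<and> t < 1 \<and> 0 \<le> x \<and> t < v x} (t,x) \<partial>lborel)
        = (\<integral>\<^sup>+ t. indicator {0<..<min 1 (v x)} t * indicator {0..} x \<partial>lborel)"
      by (intro nn_integral_cong) (auto simp: indicator_def)
    also have "\<dots> = ennreal (min 1 (v x)) * indicator {0..} x"
      using v0[of x] by (simp add: nn_integral_multc)
    finally show "(\<integral>\<^sup>+ t. indicator {(t,x). 0 < t \<and> t < 1 \<and> 0 \<le> x \<and> t < v x} (t,x) \<partial>lborel)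
        = ennreal (min 1 (v x)) * indicator {0..} x" .
  qed
  finally show ?thesis .
qed

text \<open>
  When both functions have maximum 1, the superlevel sets at a common level \<open>t < 1\<close> are nonempty
  intervals starting at 0, and their combination lies in the superlevel set of \<open>u\<close> at the same
  level. Integrating over \<open>t\<close> gives an arithmetic mean on the left, which is stronger than the
  geometric mean of the general form.
\<close>

lemma prekopa_leindler_normalized:
  fixes u v w :: "real \<Rightarrow> real" and \<kappa> :: real
  assumes l: "0 < \<kappa>" "\<kappa> < 1"
    and [measurable]: "u \<in> borel_measurable borel" "v \<in> borel_measurable borel" "w \<in> borel_measurable borel"
    and nn: "\<And>x. 0 \<le> u x" "\<And>x. 0 \<le> v x" "\<And>x. 0 \<le> w x"
    and top: "v 0 = 1" "w 0 = 1"
    and anti: "antimono_on {0..} v" "antimono_on {0..} w"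
    and comb: "\<And>x y. 0 \<le> x \<Longrightarrow> 0 \<le> y \<Longrightarrow> v x powr \<kappa> * w y powr (1 - \<kappa>) \<le> u (\<kappa> * x + (1 - \<kappa>) * y)"
  shows "\<kappa> * (\<integral>\<^sup>+ x. ennreal (v x) * indicator {0..} x \<partial>lborel)
       + (1 - \<kappa>) * (\<integral>\<^sup>+ x. ennreal (w x) * indicator {0..} x \<partial>lborel)
       \<le> (\<integral>\<^sup>+ x. ennreal (u x) * indicator {0..} x \<partial>lborel)"
proof -
  have vw: "v x \<le> 1" "w x \<le> 1" if "0 \<le> x" for x
    using monotone_onD[OF anti(1), of 0 x] monotone_onD[OF anti(2), of 0 x] top that by auto
  have lv: "(\<integral>\<^sup>+ x. ennreal (v x) * indicator {0..} x \<partial>lborel)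
      = (\<integral>\<^sup>+ t. indicator {0<..<1} t * emeasure lborel {x. 0 \<le> x \<and> t < v x} \<partial>lborel)"
    unfolding truncated_layer_cake[OF \<open>v \<in> _\<close> nn(2)]
    using vw by (intro nn_integral_cong) (auto simp: indicator_def min_def intro: antisym)
  have lw: "(\<integral>\<^sup>+ x. ennreal (w x) * indicator {0..} x \<partial>lborel)
      = (\<integral>\<^sup>+ t. indicator {0<..<1} t * emeasure lborel {x. 0 \<le> x \<and> t < w x} \<partial>lborel)"
    unfolding truncated_layer_cake[OF \<open>w \<in> _\<close> nn(3)]
    using vw by (intro nn_integral_cong) (auto simp: indicator_def min_def intro: antisym)
  have m: "(\<lambda>t. emeasure lborel {x. 0 \<le> x \<and> t < g x}) \<in> borel_measurable borel"
    if [measurable]: "g \<in> borel_measurable borel" for g :: "real \<Rightarrow> real"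
  proof -
    have "{p \<in> space (borel \<Otimes>\<^sub>M lborel). 0 \<le> snd p \<and> fst p < g (snd p)} \<in> sets (borel \<Otimes>\<^sub>M lborel)"
      by measurable
    from lborel.measurable_emeasure_Pair[OF this] show ?thesis
      by (simp add: vimage_def space_pair_measure)
  qed
  note [measurable] = m[OF \<open>v \<in> _\<close>] m[OF \<open>w \<in> _\<close>]
  have "\<kappa> * (\<integral>\<^sup>+ x. ennreal (v x) * indicator {0..} x \<partial>lborel)
       + (1 - \<kappa>) * (\<integral>\<^sup>+ x. ennreal (w x) * indicator {0..} x \<partial>lborel)
     = (\<integral>\<^sup>+ t. \<kappa> * (indicator {0<..<1} t * emeasure lborel {x. 0 \<le> x \<and> t < v x})
          + (1 - \<kappa>) * (indicator {0<..<1} t * emeasure lborel {x. 0 \<le> x \<and> t < w x}) \<partial>lborel)"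
    unfolding lv lw by (simp add: nn_integral_add nn_integral_cmult)
  also have "\<dots> \<le> (\<integral>\<^sup>+ t. indicator {0<..<1} t * emeasure lborel {x. 0 \<le> x \<and> t < u x} \<partial>lborel)"
  proof (intro nn_integral_mono)
    fix t :: real
    show "\<kappa> * (indicator {0<..<1} t * emeasure lborel {x. 0 \<le> x \<and> t < v x})
          + (1 - \<kappa>) * (indicator {0<..<1} t * emeasure lborel {x. 0 \<le> x \<and> t < w x})
        \<le> indicator {0<..<1} t * emeasure lborel {x. 0 \<le> x \<and> t < u x}"
    proof (cases "t \<in> {0<..<1}")
      case True
      then have t: "0 < t" "t < 1" by auto
      have "\<kappa> * emeasure lborel {x. 0 \<le> x \<and> t < v x} + (1 - \<kappa>) * emeasure lborel {x. 0 \<le> x \<and> t < w x}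
          \<le> emeasure lborel {x. 0 \<le> x \<and> t < u x}"
      proof (rule interval_combination_measure[OF l])
        fix x y assume *: "x \<in> {x. 0 \<le> x \<and> t < v x}" "y \<in> {x. 0 \<le> x \<and> t < w x}"
        have "t = t powr \<kappa> * t powr (1 - \<kappa>)" using t by (simp flip: powr_add)
        also have "\<dots> < v x powr \<kappa> * w y powr (1 - \<kappa>)"
          using * t l by (intro mult_strict_mono powr_less_mono2) auto
        also have "\<dots> \<le> u (\<kappa> * x + (1 - \<kappa>) * y)" using * by (intro comb) auto
        finally show "\<kappa> * x + (1 - \<kappa>) * y \<in> {x. 0 \<le> x \<and> t < u x}" using * l by auto
      next
        fix x y :: real assume "0 \<le> x" "x \<le> y" "y \<in> {x. 0 \<le> x \<and> t < v x}"
        then show "x \<in> {x. 0 \<le> x \<and> t < v x}" using monotone_onD[OF anti(1), of x y] by auto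
      next
        fix x y :: real assume "0 \<le> x" "x \<le> y" "y \<in> {x. 0 \<le> x \<and> t < w x}"
        then show "x \<in> {x. 0 \<le> x \<and> t < w x}" using monotone_onD[OF anti(2), of x y] by auto
      qed (use t top in auto)
      then show ?thesis using True by simp
    qed simp
  qed
  also have "\<dots> = (\<integral>\<^sup>+ x. ennreal (min 1 (u x)) * indicator {0..} x \<partial>lborel)"
    by (rule truncated_layer_cake) (use nn in auto)
  also have "\<dots> \<le> (\<integral>\<^sup>+ x. ennreal (u x) * indicator {0..} x \<partial>lborel)"
    by (intro nn_integral_mono mult_right_mono ennreal_leI) auto
  finally show ?thesis .
qed

text \<open>
  Dividing \<open>v\<close> and \<open>w\<close> by their maxima \<open>v 0\<close> and \<open>w 0\<close> reduces this to the normalized case; the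
  weighted inequality between arithmetic and geometric means then removes the dependence on them.
\<close>

lemma prekopa_leindler_antimono:
  fixes u v w :: "real \<Rightarrow> real" and \<kappa> :: real
  assumes l: "0 < \<kappa>" "\<kappa> < 1"
    and [measurable]: "u \<in> borel_measurable borel" "v \<in> borel_measurable borel" "w \<in> borel_measurable borel"
    and nn: "\<And>x. 0 \<le> u x" "\<And>x. 0 \<le> v x" "\<And>x. 0 \<le> w x"
    and int: "set_integrable lborel {0..} u" "set_integrable lborel {0..} v" "set_integrable lborel {0..} w"
    and anti: "antimono_on {0..} v" "antimono_on {0..} w"
    and comb: "\<And>x y. 0 \<le> x \<Longrightarrow> 0 \<le> y \<Longrightarrow> v x powr \<kappa> * w y powr (1 - \<kappa>) \<le> u (\<kappa> * x + (1 - \<kappa>) * y)"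
  shows "(LBINT x:{0..}. v x) powr \<kappa> * (LBINT x:{0..}. w x) powr (1 - \<kappa>) \<le> (LBINT x:{0..}. u x)"
proof -
  define M N where "M = v 0" and "N = w 0"
  have vM: "v x \<le> M" and wN: "w x \<le> N" if "0 \<le> x" for x
    using monotone_onD[OF anti(1), of 0 x] monotone_onD[OF anti(2), of 0 x] that by (auto simp: M_def N_def)
  have I0: "0 \<le> (LBINT x:{0..}. u x)" "0 \<le> (LBINT x:{0..}. v x)" "0 \<le> (LBINT x:{0..}. w x)"
    using nn by (auto simp: set_lebesgue_integral_def intro!: integral_nonneg_AE)
  consider "M = 0" | "N = 0" | "0 < M" "0 < N" using nn(2)[of 0] nn(3)[of 0] by (force simp: M_def N_def)
  then show ?thesis
  proof cases
    case 1
    then have z: "indicator {0..} x *\<^sub>R v x = 0" for x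
      using vM[of x] nn(2)[of x] by (cases "0 \<le> x") auto
    then have "(LBINT x:{0..}. v x) = 0" unfolding set_lebesgue_integral_def z by simp
    then show ?thesis using I0 by simp
  next
    case 2
    then have z: "indicator {0..} x *\<^sub>R w x = 0" for x
      using wN[of x] nn(3)[of x] by (cases "0 \<le> x") auto
    then have "(LBINT x:{0..}. w x) = 0" unfolding set_lebesgue_integral_def z by simp
    then show ?thesis using I0 by simp
  next
    case 3
    define c where "c = M powr \<kappa> * N powr (1 - \<kappa>)"
    have c: "0 < c" using 3 by (simp add: c_def)
    have nni: "(\<integral>\<^sup>+ x. ennreal (g x / k) * indicator {0..} x \<partial>lborel) = ennreal ((LBINT x:{0..}. g x) / k)"
      if "set_integrable lborel {0..} g" "\<And>x. 0 \<le> g x" "0 < k" for g k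
    proof -
      have "(\<integral>\<^sup>+ x. ennreal (g x / k) * indicator {0..} x \<partial>lborel)
          = (\<integral>\<^sup>+ x. ennreal (indicator {0..} x *\<^sub>R g x / k) \<partial>lborel)"
        by (intro nn_integral_cong) (auto simp: indicator_def)
      also have "\<dots> = ennreal (LINT x|lborel. indicator {0..} x *\<^sub>R g x / k)"
        using that by (intro nn_integral_eq_integral) (auto simp: set_integrable_def)
      also have "(LINT x|lborel. indicator {0..} x *\<^sub>R g x / k) = (LBINT x:{0..}. g x) / k"
        by (simp only: set_lebesgue_integral_def integral_divide_zero)
      finally show ?thesis .
    qed
    have "ennreal \<kappa> * (\<integral>\<^sup>+ x. ennreal (v x / M) * indicator {0..} x \<partial>lborel)
       + ennreal (1 - \<kappa>) * (\<integral>\<^sup>+ x. ennreal (w x / N) * indicator {0..} x \<partial>lborel)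
       \<le> (\<integral>\<^sup>+ x. ennreal (u x / c) * indicator {0..} x \<partial>lborel)"
    proof (rule prekopa_leindler_normalized[OF l])
      fix x y :: real assume xy: "0 \<le> x" "0 \<le> y"
      have "(v x / M) powr \<kappa> * (w y / N) powr (1 - \<kappa>) = v x powr \<kappa> * w y powr (1 - \<kappa>) / c"
        using nn 3 by (simp add: powr_divide c_def)
      also have "\<dots> \<le> u (\<kappa> * x + (1 - \<kappa>) * y) / c"
        using comb[OF xy] c by (simp add: divide_right_mono)
      finally show "(v x / M) powr \<kappa> * (w y / N) powr (1 - \<kappa>) \<le> u (\<kappa> * x + (1 - \<kappa>) * y) / c" .
    qed (use 3 c nn anti in \<open>auto simp: M_def N_def intro!: monotone_onI divide_right_mono dest: monotone_onD\<close>)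
    then have "ennreal (\<kappa> * ((LBINT x:{0..}. v x) / M) + (1 - \<kappa>) * ((LBINT x:{0..}. w x) / N)) \<le> ennreal ((LBINT x:{0..}. u x) / c)"
      using 3 c l I0 nn int by (simp add: nni flip: ennreal_mult' ennreal_plus)
    then have ineq: "\<kappa> * ((LBINT x:{0..}. v x) / M) + (1 - \<kappa>) * ((LBINT x:{0..}. w x) / N) \<le> (LBINT x:{0..}. u x) / c"
      using I0 c by (subst (asm) ennreal_le_iff) auto
    have "((LBINT x:{0..}. v x) / M) powr \<kappa> * ((LBINT x:{0..}. w x) / N) powr (1 - \<kappa>)
        \<le> \<kappa> * ((LBINT x:{0..}. v x) / M) + (1 - \<kappa>) * ((LBINT x:{0..}. w x) / N)"
    proof (cases "(LBINT x:{0..}. v x) = 0 \<or> (LBINT x:{0..}. w x) = 0")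
      case False
      then show ?thesis using I0 3 l by (intro Youngs_inequality_0) auto
    qed (use I0 3 l in auto)
    also note ineq
    finally have "((LBINT x:{0..}. v x) powr \<kappa> * (LBINT x:{0..}. w x) powr (1 - \<kappa>)) / c \<le> (LBINT x:{0..}. u x) / c"
      using I0 3 by (simp add: powr_divide c_def)
    then show ?thesis using c by (simp add: divide_le_cancel)
  qed
qed

section \<open>Volumes of Orlicz sublevel sets\<close>

text \<open>
  Arbitrary index sets and levels are allowed because the arguments are inductive: fixing the
  coordinate \<open>i\<close> of a point leaves the sublevel set of the other coordinates at the level
  \<open>s - f i \<bar>x i\<bar>\<close>.
\<close>

definition orlicz_sublevel :: "nat set \<Rightarrow> (nat \<Rightarrow> real \<Rightarrow> real) \<Rightarrow> real \<Rightarrow> (nat \<Rightarrow> real) set"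
  where "orlicz_sublevel I f s = {x \<in> space (\<Pi>\<^sub>M i\<in>I. lborel). (\<Sum>i\<in>I. f i \<bar>x i\<bar>) \<le> s}"

definition orlicz_volume :: "nat set \<Rightarrow> (nat \<Rightarrow> real \<Rightarrow> real) \<Rightarrow> real \<Rightarrow> real"
  where "orlicz_volume I f s = measure (\<Pi>\<^sub>M i\<in>I. lborel) (orlicz_sublevel I f s)"

interpretation lborels: product_sigma_finite "\<lambda>_::nat. lborel :: real measure" ..

lemma young_nonneg: "young_function f \<Longrightarrow> 0 \<le> x \<Longrightarrow> 0 \<le> f x"
  by (auto simp: young_function_def)

lemma young_mono: "young_function f \<Longrightarrow> 0 \<le> x \<Longrightarrow> x \<le> y \<Longrightarrow> f x \<le> f y"
  unfolding young_function_def using strict_mono_onD[of "{0..}" f x y] by (cases "x = y") simp_all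

lemma young_convex:
  assumes "young_function f" "0 \<le> x" "0 \<le> y" "0 < \<kappa>" "\<kappa> < 1"
  shows "f (\<kappa> * x + (1 - \<kappa>) * y) \<le> \<kappa> * f x + (1 - \<kappa>) * f y"
  using assms convex_onD[of "{0..}" f "1 - \<kappa>" x y] unfolding young_function_def by simp

lemma young_pos: "young_function f \<Longrightarrow> 0 < x \<Longrightarrow> 0 < f x"
  unfolding young_function_def using strict_mono_onD[of "{0..}" f 0 x] by simp

text \<open>
  Convexity and \<open>f 0 = 0\<close> force at least linear growth, \<open>f x \<ge> x * f 1\<close> for \<open>x \<ge> 1\<close>. Hence
  sublevel sets are bounded, which settles every question of integrability below.
\<close>

lemma young_bound:
  assumes f: "young_function f" and x: "0 \<le> x" "f x \<le> s"
  shows "x \<le> max 1 (s / f 1)"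
proof (cases "x \<le> 1")
  case False
  have "f (1 / x * x + (1 - 1 / x) * 0) \<le> 1 / x * f x + (1 - 1 / x) * f 0"
    using False by (intro young_convex[OF f]) auto
  then have "x * f 1 \<le> f x" using f False by (simp add: young_function_def field_simps)
  then have "x \<le> s / f 1" using x young_pos[OF f, of 1] by (simp add: field_simps)
  then show ?thesis by simp
qed simp

lemma young_measurable [measurable]:
  assumes f: "young_function f"
  shows "(\<lambda>x. f \<bar>x\<bar>) \<in> borel_measurable borel"
proof -
  \<comment> \<open>Only \<open>[0,\<infinity>)\<close> is controlled, so \<open>f\<close> is first extended by a constant.\<close>
  have "mono (\<lambda>x. f (max 0 x))" by (intro monoI young_mono[OF f]) auto
  then have "(\<lambda>x. f (max 0 x)) \<in> borel_measurable borel" by (rule borel_measurable_mono)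
  then have "(\<lambda>x. (\<lambda>x. f (max 0 x)) \<bar>x\<bar>) \<in> borel_measurable borel" by measurable
  then show ?thesis by simp
qed

lemma sets_orlicz_sublevel [measurable]:
  assumes f: "\<And>i. i \<in> I \<Longrightarrow> young_function (f i)"
  shows "orlicz_sublevel I f s \<in> sets (\<Pi>\<^sub>M i\<in>I. lborel)"
proof -
  have [measurable]: "(\<lambda>x. f i \<bar>x i\<bar>) \<in> borel_measurable (\<Pi>\<^sub>M i\<in>I. lborel)" if "i \<in> I" for i
  proof -
    have "(\<lambda>x. x i) \<in> borel_measurable (\<Pi>\<^sub>M i\<in>I. lborel)"
      using measurable_component_singleton[OF that, of "\<lambda>_. lborel"] by simp
    from measurable_compose[OF this young_measurable[OF f[OF that]]] show ?thesis .
  qed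
  have "(\<lambda>x. \<Sum>i\<in>I. f i \<bar>x i\<bar>) \<in> borel_measurable (\<Pi>\<^sub>M i\<in>I. lborel)" by measurable
  then show ?thesis unfolding orlicz_sublevel_def by measurable
qed

lemma nn_integral_orlicz_split:
  fixes \<Phi> :: "(nat \<Rightarrow> real) \<Rightarrow> ennreal"
  assumes I: "finite I" "i \<notin> I" and f: "\<And>j. j \<in> insert i I \<Longrightarrow> young_function (f j)"
    and [measurable]: "\<Phi> \<in> borel_measurable (\<Pi>\<^sub>M i\<in>insert i I. lborel)"
  shows "(\<integral>\<^sup>+ x. \<Phi> x * indicator (orlicz_sublevel (insert i I) f s) x \<partial>(\<Pi>\<^sub>M i\<in>insert i I. lborel))
    = (\<integral>\<^sup>+ y. (\<integral>\<^sup>+ x. \<Phi> (x(i := y)) * indicator (orlicz_sublevel I f (s - f i \<bar>y\<bar>)) x \<partial>(\<Pi>\<^sub>M i\<in>I. lborel)) \<partial>lborel)"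
proof -
  have [measurable]: "orlicz_sublevel (insert i I) f s \<in> sets (\<Pi>\<^sub>M i\<in>insert i I. lborel)"
    using f by (intro sets_orlicz_sublevel) auto
  have m: "(\<lambda>x. \<Phi> x * indicator (orlicz_sublevel (insert i I) f s) x) \<in> borel_measurable (\<Pi>\<^sub>M i\<in>insert i I. lborel)"
    by measurable
  show ?thesis
    unfolding lborels.product_nn_integral_insert_rev[OF I m]
  proof (intro nn_integral_cong)
    fix y :: real and x :: "nat \<Rightarrow> real"
    assume x: "x \<in> space (\<Pi>\<^sub>M i\<in>I. lborel)"
    have "(\<Sum>j\<in>I. f j \<bar>(x(i := y)) j\<bar>) = (\<Sum>j\<in>I. f j \<bar>x j\<bar>)"
      using I by (intro sum.cong) auto
    moreover have "x(i := y) \<in> space (\<Pi>\<^sub>M i\<in>insert i I. lborel)"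
      using x by (auto simp: space_PiM PiE_def extensional_def)
    ultimately have "x(i := y) \<in> orlicz_sublevel (insert i I) f s \<longleftrightarrow> x \<in> orlicz_sublevel I f (s - f i \<bar>y\<bar>)"
      using x I by (auto simp: orlicz_sublevel_def)
    then show "\<Phi> (x(i := y)) * indicator (orlicz_sublevel (insert i I) f s) (x(i := y))
        = \<Phi> (x(i := y)) * indicator (orlicz_sublevel I f (s - f i \<bar>y\<bar>)) x"
      by (simp add: indicator_def)
  qed
qed

lemma orlicz_sublevel_neg:
  assumes "\<And>i. i \<in> I \<Longrightarrow> young_function (f i)" "s < 0"
  shows "orlicz_sublevel I f s = {}"
proof -
  have "0 \<le> (\<Sum>i\<in>I. f i \<bar>x i\<bar>)" for x :: "nat \<Rightarrow> real"
    by (intro sum_nonneg) (simp add: young_nonneg[OF assms(1)])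
  then have "\<not> (\<Sum>i\<in>I. f i \<bar>x i\<bar>) \<le> s" for x :: "nat \<Rightarrow> real"
    using assms(2) by (meson le_less_trans not_le)
  then show ?thesis unfolding orlicz_sublevel_def by simp
qed

lemma emeasure_orlicz_sublevel_finite:
  assumes "finite I" "\<And>i. i \<in> I \<Longrightarrow> young_function (f i)"
  shows "emeasure (\<Pi>\<^sub>M i\<in>I. lborel) (orlicz_sublevel I f s) < \<infinity>"
  using assms
proof (induction I arbitrary: s rule: finite_induct)
  case empty
  have "emeasure (\<Pi>\<^sub>M i\<in>{}. lborel) (orlicz_sublevel {} f s) \<le> 1"
    by (rule order.trans[OF emeasure_space]) (simp add: PiM_empty)
  then show ?case by (metis ennreal_one_less_top infinity_ennreal_def le_less_trans)
next
  case (insert i I)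
  have f: "young_function (f i)" using insert by simp
  have fI: "\<And>i. i \<in> I \<Longrightarrow> young_function (f i)" using insert by simp
  define R where "R = max 1 (s / f i 1)"
  have "emeasure (\<Pi>\<^sub>M i\<in>insert i I. lborel) (orlicz_sublevel (insert i I) f s)
      = (\<integral>\<^sup>+ x. 1 * indicator (orlicz_sublevel (insert i I) f s) x \<partial>(\<Pi>\<^sub>M i\<in>insert i I. lborel))"
    using insert by (simp add: sets_orlicz_sublevel)
  also have "\<dots> = (\<integral>\<^sup>+ y. (\<integral>\<^sup>+ x. 1 * indicator (orlicz_sublevel I f (s - f i \<bar>y\<bar>)) x \<partial>(\<Pi>\<^sub>M i\<in>I. lborel)) \<partial>lborel)"
    using insert by (intro nn_integral_orlicz_split) auto
  also have "\<dots> \<le> (\<integral>\<^sup>+ y. emeasure (\<Pi>\<^sub>M i\<in>I. lborel) (orlicz_sublevel I f s) * indicator {-R..R} y \<partial>lborel)"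
  proof (intro nn_integral_mono)
    fix y :: real
    show "(\<integral>\<^sup>+ x. 1 * indicator (orlicz_sublevel I f (s - f i \<bar>y\<bar>)) x \<partial>(\<Pi>\<^sub>M i\<in>I. lborel))
       \<le> emeasure (\<Pi>\<^sub>M i\<in>I. lborel) (orlicz_sublevel I f s) * indicator {-R..R} y"
    proof (cases "y \<in> {-R..R}")
      case True
      have "orlicz_sublevel I f (s - f i \<bar>y\<bar>) \<subseteq> orlicz_sublevel I f s"
        using young_nonneg[OF f, of "\<bar>y\<bar>"] by (auto simp: orlicz_sublevel_def)
      then show ?thesis using True fI by (simp add: sets_orlicz_sublevel emeasure_mono)
    next
      case False
      then have "\<not> f i \<bar>y\<bar> \<le> s" using young_bound[OF f, of "\<bar>y\<bar>" s] by (auto simp: R_def)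
      then show ?thesis using False fI by (simp add: orlicz_sublevel_neg)
    qed
  qed
  also have "\<dots> = emeasure (\<Pi>\<^sub>M i\<in>I. lborel) (orlicz_sublevel I f s) * ennreal (R - (- R))"
    by (subst nn_integral_cmult) (auto simp: R_def)
  also have "\<dots> < \<infinity>" using insert.IH[of s] fI by (simp add: ennreal_mult_less_top)
  finally show ?case .
qed

lemma emeasure_orlicz_sublevel:
  assumes "finite I" "\<And>i. i \<in> I \<Longrightarrow> young_function (f i)"
  shows "emeasure (\<Pi>\<^sub>M i\<in>I. lborel) (orlicz_sublevel I f s) = ennreal (orlicz_volume I f s)"
  using emeasure_orlicz_sublevel_finite[OF assms]
  unfolding orlicz_volume_def by (intro emeasure_eq_ennreal_measure) (auto simp: less_top)

lemma orlicz_volume_nonneg: "0 \<le> orlicz_volume I f s"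
  by (simp add: orlicz_volume_def)

lemma orlicz_volume_neg:
  assumes "\<And>i. i \<in> I \<Longrightarrow> young_function (f i)" "s < 0"
  shows "orlicz_volume I f s = 0"
  by (simp add: orlicz_volume_def orlicz_sublevel_neg[OF assms])

lemma orlicz_volume_mono:
  assumes I: "finite I" "\<And>i. i \<in> I \<Longrightarrow> young_function (f i)" and "s \<le> t"
  shows "orlicz_volume I f s \<le> orlicz_volume I f t"
proof -
  have "orlicz_sublevel I f s \<subseteq> orlicz_sublevel I f t"
    using assms(3) by (auto simp: orlicz_sublevel_def)
  then show ?thesis unfolding orlicz_volume_def
    using emeasure_orlicz_sublevel_finite[OF I] sets_orlicz_sublevel[OF I(2)]
    by (intro measure_mono_fmeasurable) (auto simp: fmeasurable_def)
qed

lemma orlicz_volume_measurable: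
  assumes "finite I" "\<And>i. i \<in> I \<Longrightarrow> young_function (f i)"
  shows "orlicz_volume I f \<in> borel_measurable borel"
  by (intro borel_measurable_mono monoI orlicz_volume_mono assms)

lemma nn_integral_orlicz_marginal:
  fixes \<phi> :: "real \<Rightarrow> ennreal"
  assumes I: "finite I" "i \<notin> I" and f: "\<And>j. j \<in> insert i I \<Longrightarrow> young_function (f j)"
    and [measurable]: "\<phi> \<in> borel_measurable borel"
  shows "(\<integral>\<^sup>+ x. \<phi> (x i) * indicator (orlicz_sublevel (insert i I) f s) x \<partial>(\<Pi>\<^sub>M i\<in>insert i I. lborel))
    = (\<integral>\<^sup>+ y. \<phi> y * ennreal (orlicz_volume I f (s - f i \<bar>y\<bar>)) \<partial>lborel)"
proof -
  have m: "(\<lambda>x. \<phi> (x i)) \<in> borel_measurable (\<Pi>\<^sub>M i\<in>insert i I. lborel)" by measurable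
  have fI: "\<And>j. j \<in> I \<Longrightarrow> young_function (f j)" using f by simp
  show ?thesis
    by (rule trans[OF nn_integral_orlicz_split[OF I f m]])
      (use I in \<open>simp_all add: nn_integral_cmult_indicator sets_orlicz_sublevel[OF fI] emeasure_orlicz_sublevel[OF I(1) fI]\<close>)
qed

lemma nn_integral_orlicz_pair_marginal:
  fixes \<phi> :: "real \<Rightarrow> real \<Rightarrow> ennreal"
  assumes I: "finite I" "i \<notin> I" "j \<notin> I" "i \<noteq> j"
    and f: "\<And>k. k \<in> insert i (insert j I) \<Longrightarrow> young_function (f k)"
    and [measurable]: "case_prod \<phi> \<in> borel_measurable (borel \<Otimes>\<^sub>M borel)"
  shows "(\<integral>\<^sup>+ x. \<phi> (x i) (x j) * indicator (orlicz_sublevel (insert i (insert j I)) f s) x \<partial>(\<Pi>\<^sub>M i\<in>insert i (insert j I). lborel))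
    = (\<integral>\<^sup>+ y. (\<integral>\<^sup>+ z. \<phi> y z * ennreal (orlicz_volume I f (s - f i \<bar>y\<bar> - f j \<bar>z\<bar>)) \<partial>lborel) \<partial>lborel)"
proof -
  have m: "(\<lambda>x. \<phi> (x i) (x j)) \<in> borel_measurable (\<Pi>\<^sub>M i\<in>insert i (insert j I). lborel)" by measurable
  have fI: "\<And>k. k \<in> insert j I \<Longrightarrow> young_function (f k)" using f by simp
  have "(\<integral>\<^sup>+ x. \<phi> ((x(i := y)) i) ((x(i := y)) j) * indicator (orlicz_sublevel (insert j I) f (s - f i \<bar>y\<bar>)) x \<partial>(\<Pi>\<^sub>M i\<in>insert j I. lborel))
    = (\<integral>\<^sup>+ z. \<phi> y z * ennreal (orlicz_volume I f (s - f i \<bar>y\<bar> - f j \<bar>z\<bar>)) \<partial>lborel)" for y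
    using nn_integral_orlicz_marginal[where \<phi> = "\<phi> y", OF I(1,3) fI] I(4) by simp
  moreover have "finite (insert j I)" "i \<notin> insert j I" using I by auto
  ultimately show ?thesis
    by (intro trans[OF nn_integral_orlicz_split[OF _ _ f m]]) simp_all
qed

text \<open>
  Folding the line to a half-line starting at the threshold \<open>t\<close> puts tails into the form to which
  the Prekopa--Leindler inequality on \<open>[0,\<infinity>)\<close> applies.
\<close>

lemma nn_integral_even_tail:
  fixes g :: "real \<Rightarrow> ennreal"
  assumes [measurable]: "g \<in> borel_measurable borel" and t: "0 \<le> t"
  shows "(\<integral>\<^sup>+ y. indicator {y. t < \<bar>y\<bar>} y * g \<bar>y\<bar> \<partial>lborel) = 2 * (\<integral>\<^sup>+ y. g (t + y) * indicator {0..} y \<partial>lborel)"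
proof -
  have "(\<integral>\<^sup>+ y. indicator {y. t < \<bar>y\<bar>} y * g \<bar>y\<bar> \<partial>lborel)
      = (\<integral>\<^sup>+ y. indicator {t<..} y * g y + indicator {..<-t} y * g (- y) \<partial>lborel)"
    using t by (intro nn_integral_cong) (auto simp: indicator_def abs_if)
  also have "\<dots> = (\<integral>\<^sup>+ y. indicator {t<..} y * g y \<partial>lborel) + (\<integral>\<^sup>+ y. indicator {..<-t} y * g (- y) \<partial>lborel)"
    by (intro nn_integral_add) auto
  also have "(\<integral>\<^sup>+ y. indicator {t<..} y * g y \<partial>lborel) = (\<integral>\<^sup>+ y. g (t + y) * indicator {0<..} y \<partial>lborel)"
    by (subst nn_integral_real_affine[where c = 1 and t = t]) (auto simp: indicator_def intro!: nn_integral_cong)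
  also have "(\<integral>\<^sup>+ y. indicator {..<-t} y * g (- y) \<partial>lborel) = (\<integral>\<^sup>+ y. g (t + y) * indicator {0<..} y \<partial>lborel)"
    by (subst nn_integral_real_affine[where c = "-1" and t = "-t"]) (auto simp: indicator_def intro!: nn_integral_cong)
  also have "(\<integral>\<^sup>+ y. g (t + y) * indicator {0<..} y \<partial>lborel) = (\<integral>\<^sup>+ y. g (t + y) * indicator {0..} y \<partial>lborel)"
    using AE_lborel_singleton[of "0::real"]
    by (intro nn_integral_cong_AE) (auto simp: indicator_def elim!: eventually_mono)
  finally show ?thesis by (simp add: mult_2)
qed

section \<open>Log-concavity of volumes and tails\<close>

text \<open>
  For \<open>t \<ge> 0\<close> and \<open>i\<close> outside \<open>I\<close>, this is the volume of the part of the sublevel set of \<open>insert i I\<close> at level \<open>s\<close> on which \<open>\<bar>x i\<bar>\<close> exceeds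
  \<open>t\<close>, written as an integral over the half-line so that its dependence on \<open>t\<close> sits inside a
  convex function.
\<close>

definition orlicz_tail :: "nat \<Rightarrow> nat set \<Rightarrow> (nat \<Rightarrow> real \<Rightarrow> real) \<Rightarrow> real \<Rightarrow> real \<Rightarrow> real"
  where "orlicz_tail i I f s t = 2 * (LBINT y:{0..}. orlicz_volume I f (s - f i \<bar>t + y\<bar>))"

lemma orlicz_section_measurable:
  assumes I: "finite I" and f: "\<And>j. j \<in> insert i I \<Longrightarrow> young_function (f j)"
  shows "(\<lambda>y. orlicz_volume I f (s - f i \<bar>y\<bar>)) \<in> borel_measurable borel"
proof -
  have [measurable]: "orlicz_volume I f \<in> borel_measurable borel" "(\<lambda>y. f i \<bar>y\<bar>) \<in> borel_measurable borel"
    using I f by (auto intro!: orlicz_volume_measurable young_measurable)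
  show ?thesis by measurable
qed

lemma orlicz_section_measurable':
  assumes I: "finite I" and f: "\<And>j. j \<in> insert i I \<Longrightarrow> young_function (f j)"
  shows "(\<lambda>y. orlicz_volume I f (s - f i \<bar>t + y\<bar>)) \<in> borel_measurable borel"
  by (rule measurable_compose[OF _ orlicz_section_measurable[where f = f, OF assms]]) simp

lemma orlicz_section_bound:
  assumes I: "finite I" and f: "\<And>j. j \<in> insert i I \<Longrightarrow> young_function (f j)"
  shows "orlicz_volume I f (s - f i \<bar>y\<bar>) \<le> orlicz_volume I f s * indicator {- max 1 (s / f i 1) .. max 1 (s / f i 1)} y"
proof (cases "\<bar>y\<bar> \<le> max 1 (s / f i 1)")
  case True
  have "0 \<le> f i \<bar>y\<bar>" using young_nonneg[of "f i"] f by simp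
  then have "orlicz_volume I f (s - f i \<bar>y\<bar>) \<le> orlicz_volume I f s"
    using I f by (intro orlicz_volume_mono) auto
  moreover have "y \<in> {- max 1 (s / f i 1) .. max 1 (s / f i 1)}" using True unfolding abs_le_iff by auto
  ultimately show ?thesis by simp
next
  case False
  then have "\<not> f i \<bar>y\<bar> \<le> s" using young_bound[of "f i" "\<bar>y\<bar>" s] f by auto
  then have "orlicz_volume I f (s - f i \<bar>y\<bar>) = 0"
    using f by (intro orlicz_volume_neg) auto
  then show ?thesis by (simp add: orlicz_volume_nonneg)
qed

lemma orlicz_section_integrable:
  assumes I: "finite I" and f: "\<And>j. j \<in> insert i I \<Longrightarrow> young_function (f j)"
  shows "integrable lborel (\<lambda>y. orlicz_volume I f (s - f i \<bar>y\<bar>))"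
proof (rule Bochner_Integration.integrable_bound)
  show "integrable lborel (\<lambda>y. orlicz_volume I f s * indicator {- max 1 (s / f i 1) .. max 1 (s / f i 1)} y)"
    by simp
  show "AE y in lborel. norm (orlicz_volume I f (s - f i \<bar>y\<bar>))
      \<le> norm (orlicz_volume I f s * indicator {- max 1 (s / f i 1) .. max 1 (s / f i 1)} y)"
    using orlicz_section_bound[where f = f, OF assms] by (simp add: orlicz_volume_nonneg)
qed (use orlicz_section_measurable[where f = f, OF assms] in simp)

lemma orlicz_section_set_integrable:
  assumes I: "finite I" and f: "\<And>j. j \<in> insert i I \<Longrightarrow> young_function (f j)"
  shows "set_integrable lborel {0..} (\<lambda>y. orlicz_volume I f (s - f i \<bar>t + y\<bar>))"
proof -
  have "integrable lborel (\<lambda>y. orlicz_volume I f (s - f i \<bar>t + 1 * y\<bar>))"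
    using orlicz_section_integrable[where f = f and s = s, OF assms]
    by (intro lborel_integrable_real_affine) auto
  then show ?thesis unfolding set_integrable_def
    by (intro integrable_mult_indicator) auto
qed

lemma orlicz_tail_nonneg: "0 \<le> orlicz_tail i I f s t"
  unfolding orlicz_tail_def set_lebesgue_integral_def
  by (intro mult_nonneg_nonneg integral_nonneg_AE) (auto simp: orlicz_volume_nonneg)

lemma nn_integral_orlicz_tail:
  assumes I: "finite I" and f: "\<And>j. j \<in> insert i I \<Longrightarrow> young_function (f j)" and t: "0 \<le> t"
  shows "(\<integral>\<^sup>+ y. indicator {y. t < \<bar>y\<bar>} y * ennreal (orlicz_volume I f (s - f i \<bar>y\<bar>)) \<partial>lborel)
    = ennreal (orlicz_tail i I f s t)"
proof -
  have m: "(\<lambda>y. ennreal (orlicz_volume I f (s - f i \<bar>y\<bar>))) \<in> borel_measurable borel"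
    using orlicz_section_measurable[where f = f, OF I f] by simp
  have "(\<integral>\<^sup>+ y. indicator {y. t < \<bar>y\<bar>} y * ennreal (orlicz_volume I f (s - f i \<bar>y\<bar>)) \<partial>lborel)
      = 2 * (\<integral>\<^sup>+ y. ennreal (orlicz_volume I f (s - f i \<bar>t + y\<bar>)) * indicator {0..} y \<partial>lborel)"
    using nn_integral_even_tail[OF m t] by simp
  also have "(\<integral>\<^sup>+ y. ennreal (orlicz_volume I f (s - f i \<bar>t + y\<bar>)) * indicator {0..} y \<partial>lborel)
      = (\<integral>\<^sup>+ y. ennreal (indicator {0..} y *\<^sub>R orlicz_volume I f (s - f i \<bar>t + y\<bar>)) \<partial>lborel)"
    by (intro nn_integral_cong) (auto simp: indicator_def)
  also have "\<dots> = ennreal (LBINT y:{0..}. orlicz_volume I f (s - f i \<bar>t + y\<bar>))"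
    using orlicz_section_set_integrable[where f = f and s = s and t = t, OF I f] unfolding set_lebesgue_integral_def set_integrable_def
    by (intro nn_integral_eq_integral) (auto simp: orlicz_volume_nonneg)
  finally show ?thesis by (simp add: orlicz_tail_def ennreal_mult')
qed

lemma emeasure_orlicz_tail:
  assumes I: "finite I" "i \<notin> I" and f: "\<And>j. j \<in> insert i I \<Longrightarrow> young_function (f j)" and t: "0 \<le> t"
  shows "(\<integral>\<^sup>+ x. indicator {y. t < \<bar>y\<bar>} (x i) * indicator (orlicz_sublevel (insert i I) f s) x \<partial>(\<Pi>\<^sub>M i\<in>insert i I. lborel))
      = ennreal (orlicz_tail i I f s t)"
  by (rule trans[OF nn_integral_orlicz_marginal[where f = f, OF I f] nn_integral_orlicz_tail[where f = f, OF I(1) f t]]) auto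

lemma orlicz_volume_insert:
  assumes I: "finite I" "i \<notin> I" and f: "\<And>j. j \<in> insert i I \<Longrightarrow> young_function (f j)"
  shows "orlicz_volume (insert i I) f s = orlicz_tail i I f s 0"
proof -
  have "ennreal (orlicz_volume (insert i I) f s)
      = (\<integral>\<^sup>+ x. 1 * indicator (orlicz_sublevel (insert i I) f s) x \<partial>(\<Pi>\<^sub>M i\<in>insert i I. lborel))"
    using emeasure_orlicz_sublevel[where f = f and I = "insert i I", OF _ f]
      sets_orlicz_sublevel[where f = f and I = "insert i I", OF f] I by simp
  also have "\<dots> = (\<integral>\<^sup>+ y. 1 * ennreal (orlicz_volume I f (s - f i \<bar>y\<bar>)) \<partial>lborel)"
    by (rule nn_integral_orlicz_marginal[where f = f, OF I f]) auto
  \<comment> \<open>The tail beyond 0 misses only the null set \<open>{0}\<close>.\<close>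
  also have "\<dots> = (\<integral>\<^sup>+ y. indicator {y. 0 < \<bar>y\<bar>} y * ennreal (orlicz_volume I f (s - f i \<bar>y\<bar>)) \<partial>lborel)"
    using AE_lborel_singleton[of "0::real"]
    by (intro nn_integral_cong_AE) (elim eventually_mono, simp)
  also have "\<dots> = ennreal (orlicz_tail i I f s 0)"
    by (rule nn_integral_orlicz_tail[where f = f, OF I(1) f]) auto
  finally show ?thesis
    by (simp add: orlicz_volume_nonneg orlicz_tail_nonneg)
qed

text \<open>
  Joint log-concavity in level and threshold. The integrand is decreasing in \<open>y\<close>, and because
  \<open>f i\<close> is convex, the level \<open>s - f i (t + y)\<close> left to the other coordinates is concave in
  \<open>(s, t, y)\<close>; volumes increase with the level, so the hypothesis of the Prekopa--Leindler
  inequality is inherited from log-concavity of the volume in one dimension less. The case of threshold 0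
  is the induction step for the volume, the case of a fixed level gives tail bounds.
\<close>

lemma orlicz_tail_log_concave_if_volume:
  assumes I: "finite I" and f: "\<And>j. j \<in> insert i I \<Longrightarrow> young_function (f j)"
    and k: "0 < \<kappa>" "\<kappa> < 1" and t: "0 \<le> t" "0 \<le> t'"
    and vol: "\<And>s s'. orlicz_volume I f s powr \<kappa> * orlicz_volume I f s' powr (1 - \<kappa>)
      \<le> orlicz_volume I f (\<kappa> * s + (1 - \<kappa>) * s')"
  shows "orlicz_tail i I f s t powr \<kappa> * orlicz_tail i I f s' t' powr (1 - \<kappa>)
    \<le> orlicz_tail i I f (\<kappa> * s + (1 - \<kappa>) * s') (\<kappa> * t + (1 - \<kappa>) * t')"
proof -
  have fi: "young_function (f i)" and fI: "\<And>j. j \<in> I \<Longrightarrow> young_function (f j)" using f by auto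
  have anti: "antimono_on {0..} (\<lambda>y. orlicz_volume I f (s - f i \<bar>t + y\<bar>))" if "0 \<le> t" for s t
    using that young_mono[OF fi] by (intro monotone_onI orlicz_volume_mono[where f = f, OF I fI]) auto
  define J where "J s t = (LBINT y:{0..}. orlicz_volume I f (s - f i \<bar>t + y\<bar>))" for s t
  have J0: "0 \<le> J s t" for s t
    using orlicz_tail_nonneg[of i I f s t] by (simp add: J_def orlicz_tail_def)
  have "J s t powr \<kappa> * J s' t' powr (1 - \<kappa>) \<le> J (\<kappa> * s + (1 - \<kappa>) * s') (\<kappa> * t + (1 - \<kappa>) * t')"
    unfolding J_def
  proof (rule prekopa_leindler_antimono[OF k])
    fix x y :: real assume xy: "0 \<le> x" "0 \<le> y"
    have "f i (\<kappa> * (t + x) + (1 - \<kappa>) * (t' + y)) \<le> \<kappa> * f i (t + x) + (1 - \<kappa>) * f i (t' + y)"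
      using xy t k by (intro young_convex[OF fi]) auto
    moreover have "0 \<le> \<kappa> * t + (1 - \<kappa>) * t' + (\<kappa> * x + (1 - \<kappa>) * y)"
      using xy t k by (intro add_nonneg_nonneg mult_nonneg_nonneg) auto
    moreover have "\<kappa> * t + (1 - \<kappa>) * t' + (\<kappa> * x + (1 - \<kappa>) * y) = \<kappa> * (t + x) + (1 - \<kappa>) * (t' + y)"
      by (simp add: algebra_simps)
    ultimately have *: "\<kappa> * (s - f i \<bar>t + x\<bar>) + (1 - \<kappa>) * (s' - f i \<bar>t' + y\<bar>)
        \<le> \<kappa> * s + (1 - \<kappa>) * s' - f i \<bar>\<kappa> * t + (1 - \<kappa>) * t' + (\<kappa> * x + (1 - \<kappa>) * y)\<bar>"
      using xy t by (simp add: right_diff_distrib)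
    have "orlicz_volume I f (s - f i \<bar>t + x\<bar>) powr \<kappa> * orlicz_volume I f (s' - f i \<bar>t' + y\<bar>) powr (1 - \<kappa>)
        \<le> orlicz_volume I f (\<kappa> * (s - f i \<bar>t + x\<bar>) + (1 - \<kappa>) * (s' - f i \<bar>t' + y\<bar>))"
      by (rule vol)
    also have "\<dots> \<le> orlicz_volume I f (\<kappa> * s + (1 - \<kappa>) * s' - f i \<bar>\<kappa> * t + (1 - \<kappa>) * t' + (\<kappa> * x + (1 - \<kappa>) * y)\<bar>)"
      by (rule orlicz_volume_mono[where f = f, OF I fI *])
    finally show "orlicz_volume I f (s - f i \<bar>t + x\<bar>) powr \<kappa> * orlicz_volume I f (s' - f i \<bar>t' + y\<bar>) powr (1 - \<kappa>)
        \<le> orlicz_volume I f (\<kappa> * s + (1 - \<kappa>) * s' - f i \<bar>\<kappa> * t + (1 - \<kappa>) * t' + (\<kappa> * x + (1 - \<kappa>) * y)\<bar>)" .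
  qed (use t in \<open>auto intro!: orlicz_section_measurable'[where f = f, OF I f] orlicz_section_set_integrable[where f = f, OF I f] anti
       simp: orlicz_volume_nonneg\<close>)
  moreover have "(2::real) = 2 powr \<kappa> * 2 powr (1 - \<kappa>)" by (simp flip: powr_add)
  moreover have "orlicz_tail i I f s t = 2 * J s t" for s t by (simp add: orlicz_tail_def J_def)
  ultimately show ?thesis using J0 by (simp add: powr_mult mult_ac)
qed

lemma orlicz_volume_log_concave:
  assumes "finite I" "\<And>j. j \<in> I \<Longrightarrow> young_function (f j)"
    and k: "0 < \<kappa>" "\<kappa> < 1"
  shows "orlicz_volume I f s powr \<kappa> * orlicz_volume I f s' powr (1 - \<kappa>)
    \<le> orlicz_volume I f (\<kappa> * s + (1 - \<kappa>) * s')"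
  using assms(1,2)
proof (induction I arbitrary: s s' rule: finite_induct)
  case empty
  have v: "orlicz_volume {} f s = (if 0 \<le> s then 1 else 0)" for s
    by (auto simp: orlicz_volume_def orlicz_sublevel_def space_PiM measure_def PiM_empty)
  have "0 \<le> \<kappa> * s + (1 - \<kappa>) * s'" if "0 \<le> s" "0 \<le> s'"
    using that k by (intro add_nonneg_nonneg mult_nonneg_nonneg) auto
  then show ?case by (auto simp: v)
next
  case (insert i I)
  have "orlicz_tail i I f s 0 powr \<kappa> * orlicz_tail i I f s' 0 powr (1 - \<kappa>)
    \<le> orlicz_tail i I f (\<kappa> * s + (1 - \<kappa>) * s') (\<kappa> * 0 + (1 - \<kappa>) * 0)"
    using insert by (intro orlicz_tail_log_concave_if_volume k) auto
  then show ?case by (subst (1 2 3) orlicz_volume_insert) (use insert in auto)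
qed

lemma orlicz_tail_log_concave:
  assumes "finite I" "\<And>j. j \<in> insert i I \<Longrightarrow> young_function (f j)"
    and "0 < \<kappa>" "\<kappa> < 1" "0 \<le> t" "0 \<le> t'"
  shows "orlicz_tail i I f s t powr \<kappa> * orlicz_tail i I f s' t' powr (1 - \<kappa>)
    \<le> orlicz_tail i I f (\<kappa> * s + (1 - \<kappa>) * s') (\<kappa> * t + (1 - \<kappa>) * t')"
  using assms by (intro orlicz_tail_log_concave_if_volume orlicz_volume_log_concave) auto

text \<open>
  Log-concavity in the form used for correlations: moving two levels towards each other while
  keeping their sum increases the product of the volumes.
\<close>

lemma orlicz_volume_four_point:
  assumes I: "finite I" "\<And>j. j \<in> I \<Longrightarrow> young_function (f j)"
    and ord: "a \<le> b" "a \<le> c" "a + d = b + c"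
  shows "orlicz_volume I f a * orlicz_volume I f d \<le> orlicz_volume I f b * orlicz_volume I f c"
proof (cases "a = b \<or> a = c")
  case False
  then have ad: "a < d" and lt: "a < b" "b < d" using ord by auto
  define k where "k = (d - b) / (d - a)"
  have k: "0 < k" "k < 1" using ad lt by (auto simp: k_def)
  have "k * (d - a) = d - b" using ad by (simp add: k_def)
  then have b: "b = k * a + (1 - k) * d" by (simp add: algebra_simps)
  have c: "c = (1 - k) * a + (1 - (1 - k)) * d" using b ord(3) by (simp add: algebra_simps)
  let ?V = "orlicz_volume I f"
  have "?V a * ?V d = (?V a powr k * ?V a powr (1 - k)) * (?V d powr k * ?V d powr (1 - k))"
    using k by (simp add: orlicz_volume_nonneg flip: powr_add)
  also have "\<dots> = (?V a powr k * ?V d powr (1 - k)) * (?V a powr (1 - k) * ?V d powr (1 - (1 - k)))"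
    by simp
  also have "\<dots> \<le> ?V b * ?V c"
    unfolding b c using k
    by (intro mult_mono orlicz_volume_log_concave[where f = f, OF I] mult_nonneg_nonneg) (auto simp: orlicz_volume_nonneg)
  finally show ?thesis .
qed (use ord in \<open>auto simp: mult.commute\<close>)

text \<open>
  A log-concave tail which starts at 1 decays geometrically from the first scale \<open>t\<close> at which it is
  known to be at most \<open>q\<close>: the value at \<open>t\<close> is at least the geometric interpolation between the
  values at 0 and at \<open>k * t\<close>.
\<close>

lemma orlicz_tail_geometric:
  assumes I: "finite I" "\<And>j. j \<in> insert i I \<Longrightarrow> young_function (f j)"
    and one: "orlicz_tail i I f s 0 = 1" and q: "orlicz_tail i I f s t \<le> q" and t: "0 \<le> t"
  shows "orlicz_tail i I f s (real k * t) \<le> q ^ k"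
proof (cases "k \<le> 1")
  case True
  then have "k = 0 \<or> k = 1" by auto
  then show ?thesis using one q by auto
next
  case False
  define T where "T = orlicz_tail i I f s"
  have T0: "0 \<le> T x" for x by (simp add: T_def orlicz_tail_nonneg)
  have "T (real k * t) powr (1 / k) * T 0 powr (1 - 1 / k)
      \<le> orlicz_tail i I f (1 / k * s + (1 - 1 / k) * s) (1 / k * (real k * t) + (1 - 1 / k) * 0)"
    unfolding T_def using False t by (intro orlicz_tail_log_concave I) auto
  also have "1 / k * s + (1 - 1 / k) * s = s" by (simp add: algebra_simps)
  also have "1 / k * (real k * t) + (1 - 1 / k) * 0 = t" using False by simp
  finally have "T (real k * t) powr (1 / k) \<le> q" using one q by (simp add: T_def)
  then have "(T (real k * t) powr (1 / k)) ^ k \<le> q ^ k" by (intro power_mono) auto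
  moreover have "(T (real k * t) powr (1 / k)) ^ k = T (real k * t)"
    using False T0[of "real k * t"] by (simp add: powr_realpow' powr_powr flip: powr_realpow')
  ultimately show ?thesis by (simp add: T_def)
qed

section \<open>Negative correlation of squares and moments from tails\<close>

lemma integral_nonpos:
  fixes h :: "'a \<Rightarrow> real"
  assumes "\<And>x. h x \<le> 0"
  shows "(LINT x|M. h x) \<le> 0"
  using integral_nonneg_AE[of "\<lambda>x. - h x" M] assms by simp

text \<open>
  If \<open>b\<close> increases where the ratio of \<open>P\<close> to \<open>Q\<close> decreases, then the mean of \<open>b\<close> with respect to the
  weight \<open>P\<close> is at most that with respect to \<open>Q\<close>. Integrating the hypothesis over both variables
  gives twice the asserted difference.
\<close>

lemma chebyshev_integral_inequality:
  fixes P Q b :: "'a \<Rightarrow> real"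
  assumes [simp]: "integrable M P" "integrable M Q" "integrable M (\<lambda>z. b z * P z)" "integrable M (\<lambda>z. b z * Q z)"
    and opp: "\<And>z z'. (b z - b z') * (P z * Q z' - P z' * Q z) \<le> 0"
  shows "(LINT z|M. b z * P z) * (LINT z|M. Q z) \<le> (LINT z|M. P z) * (LINT z|M. b z * Q z)"
proof -
  define p q bp bq where "p = (LINT z|M. P z)" and "q = (LINT z|M. Q z)"
    and "bp = (LINT z|M. b z * P z)" and "bq = (LINT z|M. b z * Q z)"
  have "(b z * P z) * q - (b z * Q z) * p - P z * bq + Q z * bp \<le> 0" for z
  proof -
    have "(b z * P z) * q - (b z * Q z) * p - P z * bq + Q z * bp
        = (LINT z'|M. (b z * P z) * Q z' - (b z * Q z) * P z' - P z * (b z' * Q z') + Q z * (b z' * P z'))"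
      by (simp add: p_def q_def bp_def bq_def)
    also have "\<dots> = (LINT z'|M. (b z - b z') * (P z * Q z' - P z' * Q z))"
      by (intro Bochner_Integration.integral_cong) (auto simp: algebra_simps)
    also have "\<dots> \<le> 0" by (intro integral_nonpos opp)
    finally show ?thesis .
  qed
  then have "(LINT z|M. (b z * P z) * q - (b z * Q z) * p - P z * bq + Q z * bp) \<le> 0"
    by (intro integral_nonpos)
  also have "(LINT z|M. (b z * P z) * q - (b z * Q z) * p - P z * bq + Q z * bp) = bp * q - bq * p - p * bq + q * bp"
    by (simp add: p_def q_def bp_def bq_def)
  finally show ?thesis by (simp add: p_def q_def bp_def bq_def algebra_simps)
qed

lemma integrable_bounded_on_box:
  fixes h :: "real \<Rightarrow> real \<Rightarrow> real"
  assumes [measurable]: "case_prod h \<in> borel_measurable (borel \<Otimes>\<^sub>M borel)"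
    and b: "\<And>x z. \<bar>h x z\<bar> \<le> C * indicator {-R..R} x * indicator {-S..S} z"
  shows "integrable (lborel \<Otimes>\<^sub>M lborel) (case_prod h)" "integrable lborel (h x)"
    "integrable lborel (\<lambda>x. LINT z|lborel. h x z)"
proof -
  have "emeasure (lborel \<Otimes>\<^sub>M lborel) ({-R..R} \<times> {-S..S}) < \<infinity>"
    by (subst lborel.emeasure_pair_measure_Times) (auto simp: emeasure_lborel_Icc_eq ennreal_mult_less_top)
  then have "integrable (lborel \<Otimes>\<^sub>M lborel) (\<lambda>p. C * indicator ({-R..R} \<times> {-S..S}) p)"
    by (intro integrable_mult_right integrable_real_indicator) auto
  then show *: "integrable (lborel \<Otimes>\<^sub>M lborel) (case_prod h)"
  proof (rule Bochner_Integration.integrable_bound)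
    have "norm (case_prod h p) \<le> norm (C * indicator ({-R..R} \<times> {-S..S}) p)" for p
      using order.trans[OF b[of "fst p" "snd p"] abs_ge_self] by (cases p) (simp add: indicator_times mult.assoc)
    then show "AE p in lborel \<Otimes>\<^sub>M lborel. norm (case_prod h p) \<le> norm (C * indicator ({-R..R} \<times> {-S..S}) p)"
      by simp
  qed simp
  show "integrable lborel (\<lambda>x. LINT z|lborel. h x z)"
    using lborel_pair.integrable_fst'[OF *] by simp
  have "integrable lborel (\<lambda>z. C * indicator {-R..R} x * indicator {-S..S} z :: real)"
    by (intro integrable_mult_right integrable_real_indicator) (auto simp: emeasure_lborel_Icc_eq)
  then show "integrable lborel (h x)"
    by (rule Bochner_Integration.integrable_bound)
      (use b in \<open>auto intro!: AE_I2 order.trans[OF _ abs_ge_self]\<close>)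
qed

lemma nn_integral_iterated:
  fixes h :: "real \<Rightarrow> real \<Rightarrow> real"
  assumes m: "case_prod h \<in> borel_measurable (borel \<Otimes>\<^sub>M borel)"
    and b: "\<And>x z. \<bar>h x z\<bar> \<le> C * indicator {-R..R} x * indicator {-S..S} z"
    and nn: "\<And>x z. 0 \<le> h x z"
  shows "(\<integral>\<^sup>+ x. (\<integral>\<^sup>+ z. ennreal (h x z) \<partial>lborel) \<partial>lborel) = ennreal (LINT x|lborel. LINT z|lborel. h x z)"
proof -
  have "(\<integral>\<^sup>+ z. ennreal (h x z) \<partial>lborel) = ennreal (LINT z|lborel. h x z)" for x
    using integrable_bounded_on_box(2)[OF m b] nn by (intro nn_integral_eq_integral) auto
  then show ?thesis
    using integrable_bounded_on_box(3)[OF m b] nn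
    by (simp add: nn_integral_eq_integral integral_nonneg_AE)
qed

text \<open>
  With all other coordinates integrated out, the density of \<open>(x i, x j)\<close> is
  \<open>p y z = V (s - f i \<bar>y\<bar> - f j \<bar>z\<bar>)\<close> for a log-concave \<open>V\<close>. Increasing \<open>\<bar>y\<bar>\<close> and increasing
  \<open>\<bar>z\<bar>\<close> lower the level by independent amounts, so the four-point inequality says that \<open>p\<close> is
  reverse totally positive in \<open>(\<bar>y\<bar>, \<bar>z\<bar>)\<close>: the larger \<open>\<bar>y\<bar>\<close>, the more the conditional law of \<open>z\<close>
  concentrates near 0. Chebyshev's inequality in \<open>z\<close> turns this into monotonicity of the
  conditional second moment of \<open>z\<close> given \<open>y\<close>, and a second application, in \<open>y\<close>, into negative
  correlation of the squares.
\<close>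

lemma orlicz_square_negative_correlation:
  fixes s :: real
  assumes I: "finite I" "i \<notin> I" "j \<notin> I" "i \<noteq> j"
    and f: "\<And>k. k \<in> insert i (insert j I) \<Longrightarrow> young_function (f k)"
  defines "N \<equiv> (\<lambda>\<phi>. \<integral>\<^sup>+ x. ennreal (\<phi> (x i) (x j)) * indicator (orlicz_sublevel (insert i (insert j I)) f s) x
      \<partial>(\<Pi>\<^sub>M i\<in>insert i (insert j I). lborel))"
  shows "N (\<lambda>y z. y\<^sup>2 * z\<^sup>2) * N (\<lambda>y z. 1) \<le> N (\<lambda>y z. y\<^sup>2) * N (\<lambda>y z. z\<^sup>2)"
proof -
  have fi: "young_function (f i)" and fj: "young_function (f j)" and fI: "\<And>k. k \<in> I \<Longrightarrow> young_function (f k)"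
    using f by auto
  define p where "p y z = orlicz_volume I f (s - f i \<bar>y\<bar> - f j \<bar>z\<bar>)" for y z
  define C where "C = orlicz_volume I f s"
  define R where "R = max 1 (s / f i 1)"
  define S where "S = max 1 (s / f j 1)"
  have p0: "0 \<le> p y z" for y z by (simp add: p_def orlicz_volume_nonneg)
  have C0: "0 \<le> C" by (simp add: C_def orlicz_volume_nonneg)
  have [measurable]: "orlicz_volume I f \<in> borel_measurable borel" by (rule orlicz_volume_measurable[OF I(1) fI])
  have [measurable]: "(\<lambda>y. f i \<bar>y\<bar>) \<in> borel_measurable borel" "(\<lambda>y. f j \<bar>y\<bar>) \<in> borel_measurable borel"
    using fi fj by measurable
  have [measurable]: "case_prod p \<in> borel_measurable (borel \<Otimes>\<^sub>M borel)"
    unfolding p_def by measurable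
  have pb: "p y z \<le> C * indicator {-R..R} y * indicator {-S..S} z" for y z
  proof (cases "f i \<bar>y\<bar> \<le> s \<and> f j \<bar>z\<bar> \<le> s")
    case True
    then have "\<bar>y\<bar> \<le> R" "\<bar>z\<bar> \<le> S"
      using young_bound[OF fi, of "\<bar>y\<bar>" s] young_bound[OF fj, of "\<bar>z\<bar>" s] by (auto simp: R_def S_def)
    then have "y \<in> {-R..R}" "z \<in> {-S..S}" by (auto simp: abs_le_iff)
    moreover have "p y z \<le> C" unfolding p_def C_def
      using young_nonneg[OF fi, of "\<bar>y\<bar>"] young_nonneg[OF fj, of "\<bar>z\<bar>"]
      by (intro orlicz_volume_mono[where f = f, OF I(1) fI]) auto
    ultimately show ?thesis by simp
  next
    case False
    then have "s - f i \<bar>y\<bar> - f j \<bar>z\<bar> < 0"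
      using young_nonneg[OF fi, of "\<bar>y\<bar>"] young_nonneg[OF fj, of "\<bar>z\<bar>"] by linarith
    then have "p y z = 0" unfolding p_def by (intro orlicz_volume_neg[where f = f, OF fI])
    then show ?thesis using C0 by simp
  qed
  have four: "p y' z' * p y z \<le> p y' z * p y z'" if "\<bar>y\<bar> \<le> \<bar>y'\<bar>" "\<bar>z\<bar> \<le> \<bar>z'\<bar>" for y y' z z'
    unfolding p_def
    using young_mono[OF fi _ that(1)] young_mono[OF fj _ that(2)]
    by (intro orlicz_volume_four_point[where f = f, OF I(1) fI]) auto
  have bnd: "\<bar>y ^ a * (z ^ b * p y z)\<bar> \<le> (R ^ a * S ^ b * C) * indicator {-R..R} y * indicator {-S..S} z" for a b y z
  proof (cases "y \<in> {-R..R} \<and> z \<in> {-S..S}")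
    case True
    then have "\<bar>y\<bar> \<le> R" "\<bar>z\<bar> \<le> S" by auto
    then have "\<bar>y\<bar> ^ a * (\<bar>z\<bar> ^ b * p y z) \<le> R ^ a * (S ^ b * C)"
      using pb[of y z] p0[of y z] True
      by (intro mult_mono power_mono) (auto simp: R_def S_def intro!: mult_nonneg_nonneg)
    then show ?thesis using True p0 by (simp add: abs_mult power_abs mult_ac)
  next
    case False
    then have "p y z = 0" using pb[of y z] p0[of y z] by (auto simp: indicator_def split: if_splits)
    then show ?thesis using C0 by (auto simp: R_def S_def)
  qed
  have mm: "(\<lambda>(y, z). y ^ a * (z ^ b * p y z)) \<in> borel_measurable (borel \<Otimes>\<^sub>M borel)" for a b
    by measurable
  define A where "A y = (LINT z|lborel. p y z)" for y
  define B where "B y = (LINT z|lborel. z\<^sup>2 * p y z)" for y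
  have iz: "integrable lborel (\<lambda>z. z ^ b * p y z)" for b y
    using integrable_bounded_on_box(2)[OF mm[of 0 b] bnd] by simp
  have iA: "integrable lborel (\<lambda>y. y ^ a * A y)" and iB: "integrable lborel (\<lambda>y. y ^ a * B y)" for a
    using integrable_bounded_on_box(3)[OF mm[of a 0] bnd] integrable_bounded_on_box(3)[OF mm[of a 2] bnd]
    by (simp_all add: A_def B_def)
  have sq: "(y\<^sup>2 - y'\<^sup>2) \<le> 0 \<longleftrightarrow> \<bar>y\<bar> \<le> \<bar>y'\<bar>" for y y' :: real
    by (simp add: abs_le_square_iff)
  \<comment> \<open>The ratio of \<open>B\<close> to \<open>A\<close> is the conditional second moment of \<open>z\<close>; it decreases in \<open>\<bar>y\<bar>\<close>.\<close>
  have AB: "B y' * A y \<le> A y' * B y" if y: "\<bar>y\<bar> \<le> \<bar>y'\<bar>" for y y'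
    unfolding A_def B_def
  proof (rule chebyshev_integral_inequality)
    fix z z' :: real
    show "(z\<^sup>2 - z'\<^sup>2) * (p y' z * p y z' - p y' z' * p y z) \<le> 0"
    proof (cases "\<bar>z\<bar> \<le> \<bar>z'\<bar>")
      case True
      then show ?thesis using four[OF y True] sq[of z z'] by (intro mult_nonpos_nonneg) (simp_all add: mult.commute)
    next
      case False
      then show ?thesis using four[OF y, of z' z] sq[of z' z] by (intro mult_nonneg_nonpos) (simp_all add: mult.commute)
    qed
  qed (use iz[of 0] iz[of 2] in auto)
  have main: "(LINT y|lborel. y\<^sup>2 * B y) * (LINT y|lborel. A y) \<le> (LINT y|lborel. B y) * (LINT y|lborel. y\<^sup>2 * A y)"
  proof (rule chebyshev_integral_inequality)
    fix y y' :: real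
    show "(y\<^sup>2 - y'\<^sup>2) * (B y * A y' - B y' * A y) \<le> 0"
    proof (cases "\<bar>y\<bar> \<le> \<bar>y'\<bar>")
      case True
      then show ?thesis using AB[OF True] sq[of y y'] by (intro mult_nonpos_nonneg) (simp_all add: mult.commute)
    next
      case False
      then show ?thesis using AB[of y' y] sq[of y' y] by (intro mult_nonneg_nonpos) (simp_all add: mult.commute)
    qed
  qed (use iA[of 0] iA[of 2] iB[of 0] iB[of 2] in auto)
  have N: "N (\<lambda>y z. y ^ a * z ^ b) = ennreal (LINT y|lborel. y ^ a * (LINT z|lborel. z ^ b * p y z))"
    if "even a" "even b" for a b
  proof -
    have "N (\<lambda>y z. y ^ a * z ^ b) = (\<integral>\<^sup>+ y. (\<integral>\<^sup>+ z. ennreal (y ^ a * z ^ b) * ennreal (p y z) \<partial>lborel) \<partial>lborel)"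
      unfolding N_def p_def by (rule nn_integral_orlicz_pair_marginal[where f = f, OF I f]) measurable
    also have "\<dots> = (\<integral>\<^sup>+ y. (\<integral>\<^sup>+ z. ennreal (y ^ a * (z ^ b * p y z)) \<partial>lborel) \<partial>lborel)"
      using that by (simp add: ennreal_mult'' p0 mult.assoc flip: ennreal_mult'')
    also have "\<dots> = ennreal (LINT y|lborel. LINT z|lborel. y ^ a * (z ^ b * p y z))"
      using that p0 by (intro nn_integral_iterated[OF mm bnd]) (auto simp: zero_le_even_power)
    finally show ?thesis by simp
  qed
  have nn: "0 \<le> (LINT y|lborel. A y)" "0 \<le> (LINT y|lborel. y\<^sup>2 * A y)"
      "0 \<le> (LINT y|lborel. B y)" "0 \<le> (LINT y|lborel. y\<^sup>2 * B y)"
    unfolding A_def B_def using p0 by (auto intro!: integral_nonneg_AE AE_I2 mult_nonneg_nonneg)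
  have "N (\<lambda>y z. 1) = ennreal (LINT y|lborel. A y)" "N (\<lambda>y z. y\<^sup>2) = ennreal (LINT y|lborel. y\<^sup>2 * A y)"
      "N (\<lambda>y z. z\<^sup>2) = ennreal (LINT y|lborel. B y)" "N (\<lambda>y z. y\<^sup>2 * z\<^sup>2) = ennreal (LINT y|lborel. y\<^sup>2 * B y)"
    using N[of 0 0] N[of 2 0] N[of 0 2] N[of 2 2] by (simp_all add: A_def B_def)
  then show ?thesis
    using main nn by (simp add: ennreal_leI mult.commute flip: ennreal_mult)
qed

definition sixth_moment_bound :: real
  where "sixth_moment_bound = (\<Sum>k. (real k + 1) ^ 6 * (1 / 4) ^ k)"

text \<open>
  From \<open>k = 8\<close> on, the polynomial factor grows by less than \<open>(10 / 9) ^ 6 < 2\<close> per step.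
\<close>

lemma sixth_moment_bound_summable: "summable (\<lambda>k. (real k + 1) ^ 6 * (1 / 4) ^ k)"
proof (rule summable_ratio_test[of "1/2" 8])
  fix k :: nat assume k: "8 \<le> k"
  then have "real k + 2 \<le> 10 / 9 * (real k + 1)" by simp
  then have "(real k + 2) ^ 6 \<le> (10 / 9 * (real k + 1)) ^ 6" by (intro power_mono) auto
  also have "\<dots> \<le> 2 * (real k + 1) ^ 6" unfolding power_mult_distrib
    by (intro mult_right_mono) (auto simp: power_divide)
  finally show "norm ((real (Suc k) + 1) ^ 6 * (1 / 4) ^ Suc k) \<le> 1 / 2 * norm ((real k + 1) ^ 6 * (1 / 4) ^ k)"
    by (simp add: add.commute norm_mult norm_power)
qed simp

lemma sixth_moment_bound_nonneg: "0 \<le> sixth_moment_bound"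
  unfolding sixth_moment_bound_def by (intro suminf_nonneg sixth_moment_bound_summable) auto

text \<open>
  A value in \<open>(k, k + 1]\<close> is charged to the single threshold \<open>k\<close>, with weight \<open>(k + 1) ^ 6\<close>.
\<close>

lemma sixth_moment_from_tail:
  fixes g :: "'a \<Rightarrow> real"
  assumes [measurable]: "g \<in> borel_measurable M" and g0: "\<And>x. 0 \<le> g x"
    and tail: "\<And>k. emeasure M {x \<in> space M. real k < g x} \<le> ennreal ((1 / 4) ^ k)"
  shows "(\<integral>\<^sup>+ x. ennreal (g x ^ 6) \<partial>M) \<le> ennreal sixth_moment_bound"
proof -
  let ?T = "\<lambda>k x. ennreal ((real k + 1) ^ 6) * indicator {x \<in> space M. real k < g x} x"
  have "(\<integral>\<^sup>+ x. ennreal (g x ^ 6) \<partial>M) \<le> (\<integral>\<^sup>+ x. (\<Sum>k. ?T k x) \<partial>M)"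
  proof (intro nn_integral_mono)
    fix x assume x: "x \<in> space M"
    show "ennreal (g x ^ 6) \<le> (\<Sum>k. ?T k x)"
    proof (cases "g x = 0")
      case False
      then have gp: "0 < g x" using g0[of x] by simp
      define k where "k = nat (\<lceil>g x\<rceil> - 1)"
      have k: "real k < g x" "g x \<le> real k + 1" using gp unfolding k_def by linarith+
      have "ennreal (g x ^ 6) \<le> ?T k x" using k x gp by (auto intro!: ennreal_leI power_mono)
      also have "\<dots> \<le> (\<Sum>k. ?T k x)"
      proof -
        have "F k \<le> suminf F" for F :: "nat \<Rightarrow> ennreal"
          using sum_le_suminf[of F "{k}"] by simp
        then show ?thesis .
      qed
      finally show ?thesis .
    qed simp
  qed
  also have "\<dots> = (\<Sum>k. ennreal ((real k + 1) ^ 6) * emeasure M {x \<in> space M. real k < g x})"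
    by (subst nn_integral_suminf) (simp_all add: nn_integral_cmult_indicator)
  also have "\<dots> \<le> (\<Sum>k. ennreal ((real k + 1) ^ 6) * ennreal ((1 / 4) ^ k))"
    by (intro suminf_le mult_left_mono tail) auto
  also have "\<dots> = ennreal sixth_moment_bound"
    unfolding sixth_moment_bound_def
    by (subst suminf_ennreal2[symmetric]) (auto simp: sixth_moment_bound_summable ennreal_mult)
  finally show ?thesis .
qed

section \<open>Stein's equation\<close>

lemma DERIV_set_integral_atMost:
  fixes g :: "real \<Rightarrow> real"
  assumes g: "continuous_on UNIV g" "integrable lborel g"
  shows "((\<lambda>x. LBINT s:{..x}. g s) has_real_derivative g x) (at x)"
proof -
  define a where "a = x - 1"
  have si: "set_integrable lborel A g" if "A \<in> sets borel" for A
    using g(2) that unfolding set_integrable_def by (intro integrable_mult_indicator) auto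
  have split: "(LBINT s:{..u}. g s) = (LBINT s:{..<a}. g s) + integral {a..u} g" if "a \<le> u" for u
  proof -
    have "{..u} = {..<a} \<union> {a..u}" using that by auto
    moreover have "(LBINT s:{..<a} \<union> {a..u}. g s) = (LBINT s:{..<a}. g s) + (LBINT s:{a..u}. g s)"
      by (intro set_integral_Un si) auto
    ultimately have "(LBINT s:{..u}. g s) = (LBINT s:{..<a}. g s) + (LBINT s:{a..u}. g s)" by simp
    then show ?thesis by (simp add: set_borel_integral_eq_integral(2) si)
  qed
  have "((\<lambda>u. integral {a..u} g) has_real_derivative g x) (at x within {a..x + 1})"
    using g(1) by (intro integral_has_real_derivative) (auto simp: a_def intro: continuous_on_subset)
  then have "((\<lambda>u. integral {a..u} g) has_real_derivative g x) (at x)"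
    by (simp add: at_within_Icc_at a_def)
  then have "((\<lambda>u. (LBINT s:{..<a}. g s) + integral {a..u} g) has_real_derivative 0 + g x) (at x)"
    by (intro DERIV_add DERIV_const)
  then have "((\<lambda>u. (LBINT s:{..<a}. g s) + integral {a..u} g) has_real_derivative g x) (at x)" by simp
  then show ?thesis
    by (rule has_field_derivative_transform_within_open[of _ _ _ "{a<..}"]) (auto simp: a_def split)
qed

lemma DERIV_std_normal_density:
  "(std_normal_density has_real_derivative - x * std_normal_density x) (at x)"
proof -
  have "((\<lambda>x. k * exp (- x\<^sup>2 / 2)) has_real_derivative - x * (k * exp (- x\<^sup>2 / 2))) (at x)" for k :: real
    by (auto intro!: derivative_eq_intros)
  from this[of "1 / sqrt (2 * pi)"] show ?thesis by (simp only: std_normal_density_def[symmetric])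
qed

lemma std_normal_density_le: "std_normal_density x \<le> 1 / sqrt (2 * pi)"
  by (simp add: std_normal_density_def divide_right_mono)

lemma std_normal_density_tendsto: "(std_normal_density \<longlongrightarrow> 0) at_top"
proof -
  have "filterlim (\<lambda>s::real. s\<^sup>2 / 2) at_top at_top"
  proof (rule filterlim_at_top_mono[OF filterlim_ident])
    have "s \<le> s\<^sup>2 / 2" if "2 \<le> s" for s :: real
      using mult_right_mono[OF that, of s] that by (simp add: power2_eq_square)
    then show "\<forall>\<^sub>F s::real in at_top. s \<le> s\<^sup>2 / 2"
      using eventually_ge_at_top[of "2::real"] by (rule eventually_mono[rotated])
  qed
  then have "((\<lambda>s::real. exp (- (s\<^sup>2 / 2))) \<longlongrightarrow> 0) at_top"
    by (intro filterlim_compose[OF exp_at_bot]) (simp add: filterlim_uminus_at_bot)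
  from tendsto_mult_left[OF this, of "1 / sqrt (2 * pi)"]
  have "((\<lambda>s. (1 / sqrt (2 * pi)) * exp (- s\<^sup>2 / 2)) \<longlongrightarrow> 0) at_top" by simp
  then show ?thesis by (simp only: std_normal_density_def[symmetric])
qed

lemma std_normal_set_integrable: "A \<in> sets borel \<Longrightarrow> set_integrable lborel A std_normal_density"
  unfolding set_integrable_def by (intro integrable_mult_indicator) auto

text \<open>
  For \<open>s \<ge> x\<close> the factor \<open>x\<close> may be replaced by \<open>s\<close>, and \<open>s * \<phi> s\<close> is the derivative of
  \<open>- \<phi> s\<close>.
\<close>

lemma mills_ratio_atLeast:
  assumes x: "0 \<le> x"
  shows "x * (LBINT s:{x..}. std_normal_density s) \<le> std_normal_density x"
proof -
  have i: "set_integrable lborel {x..} (\<lambda>s. s * std_normal_density s)"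
    using integrable_std_normal_moment[of 1] unfolding set_integrable_def
    by (intro integrable_mult_indicator) (auto simp: mult.commute)
  have "(\<integral>\<^sup>+s. ennreal (s * std_normal_density s) * indicator {x..} s \<partial>lborel) = ennreal (0 - (- std_normal_density x))"
  proof (rule nn_integral_FTC_atLeast)
    show "((\<lambda>x. - std_normal_density x) has_real_derivative y * std_normal_density y) (at y)" for y
      using DERIV_minus[OF DERIV_std_normal_density[of y]] by simp
    show "((\<lambda>x. - std_normal_density x) \<longlongrightarrow> 0) at_top"
      using tendsto_minus[OF std_normal_density_tendsto] by simp
  qed (use x in auto)
  moreover have "(\<integral>\<^sup>+s. ennreal (s * std_normal_density s) * indicator {x..} s \<partial>lborel)
      = ennreal (LBINT s:{x..}. s * std_normal_density s)"
  proof -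
    have "(\<integral>\<^sup>+s. ennreal (s * std_normal_density s) * indicator {x..} s \<partial>lborel)
      = (\<integral>\<^sup>+s. ennreal (indicator {x..} s *\<^sub>R (s * std_normal_density s)) \<partial>lborel)"
      by (intro nn_integral_cong) (auto simp: indicator_def)
    also have "\<dots> = ennreal (LBINT s:{x..}. s * std_normal_density s)"
      unfolding set_lebesgue_integral_def using i[unfolded set_integrable_def] x
      by (intro nn_integral_eq_integral) (auto simp: indicator_def)
    finally show ?thesis .
  qed
  moreover have "0 \<le> (LBINT s:{x..}. s * std_normal_density s)"
    unfolding set_lebesgue_integral_def using x by (intro integral_nonneg_AE) (auto simp: indicator_def)
  ultimately have eq: "(LBINT s:{x..}. s * std_normal_density s) = std_normal_density x" by simp
  have "x * (LBINT s:{x..}. std_normal_density s) = (LBINT s:{x..}. x * std_normal_density s)"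
    by simp
  also have "\<dots> \<le> (LBINT s:{x..}. s * std_normal_density s)"
    using std_normal_set_integrable i
    by (intro set_integral_mono set_integrable_mult_right mult_right_mono) auto
  finally show ?thesis using eq by simp
qed

lemma std_normal_reflect:
  "(LBINT s:{..x}. std_normal_density s) = (LBINT s:{-x..}. std_normal_density s)"
  unfolding set_lebesgue_integral_def
  by (subst lborel_integral_real_affine[where c = "-1" and t = 0])
    (auto simp: std_normal_density_def indicator_def intro!: Bochner_Integration.integral_cong)

definition stein_const :: real
  where "stein_const = 1 + 1 / std_normal_density 1"

text \<open>
  Stein's equation \<open>f' x - x * f x = h x - c\<close> is solved by dividing by the Gaussian density \<open>\<phi>\<close> the
  integral \<open>H\<close> of \<open>(h - c) * \<phi>\<close> up to \<open>x\<close>. Since \<open>c\<close> is the Gaussian mean of \<open>h\<close>, this is also minus the integral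
  beyond \<open>x\<close>, so \<open>\<bar>H x\<bar>\<close> is at most either Gaussian tail at \<open>x\<close> and the Mills ratio bounds \<open>x * f x\<close>
  by 1. Everything else follows from the equation itself: \<open>f'\<close> is bounded because \<open>x * f x\<close> and
  \<open>h\<close> are, and it is locally Lipschitz because \<open>h\<close> is Lipschitz and \<open>f\<close> is bounded and Lipschitz.
  The term \<open>2 * \<bar>y\<bar>\<close> in the local Lipschitz constant is harmless when it is integrated against
  a random variable of bounded variance.
\<close>

lemma stein_solution_exists:
  fixes h :: "real \<Rightarrow> real" and \<Lambda> :: real
  assumes h: "\<And>x. 0 \<le> h x" "\<And>x. h x \<le> 1"
    and lip: "\<And>x y. \<bar>h x - h y\<bar> \<le> \<Lambda> * \<bar>x - y\<bar>"
  defines "c \<equiv> (LBINT x. h x * std_normal_density x)"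
  shows "\<exists>f f'. (\<forall>x. (f has_real_derivative f' x) (at x)) \<and> (\<forall>x. f' x - x * f x = h x - c)
    \<and> (\<forall>x. \<bar>f x\<bar> \<le> stein_const) \<and> (\<forall>x. \<bar>f' x\<bar> \<le> 2)
    \<and> (\<forall>x y. \<bar>f' x - f' y\<bar> \<le> (stein_const + 2 * \<bar>y\<bar> + \<Lambda>) * \<bar>x - y\<bar>)"
proof -
  let ?\<phi> = std_normal_density
  have \<Lambda>: "0 \<le> \<Lambda>" using lip[of 0 1] by simp
  have "continuous (at x) h" for x
  proof -
    have "((\<lambda>y. \<Lambda> * \<bar>y - x\<bar>) \<longlongrightarrow> \<Lambda> * \<bar>x - x\<bar>) (at x)" by (intro tendsto_intros)
    then have "((\<lambda>y. h y - h x) \<longlongrightarrow> 0) (at x)"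
      by (intro Lim_null_comparison[of "\<lambda>y. h y - h x" "\<lambda>y. \<Lambda> * \<bar>y - x\<bar>"]) (auto intro!: always_eventually lip)
    then show ?thesis unfolding continuous_at by (simp add: LIM_zero_iff)
  qed
  then have hc: "continuous_on UNIV h" by (simp add: continuous_on_eq_continuous_at)
  then have [measurable]: "h \<in> borel_measurable borel" by (rule borel_measurable_continuous_onI)
  have "integrable lborel ?\<phi>" by simp
  then have hi: "integrable lborel (\<lambda>x. h x * ?\<phi> x)"
    by (rule Bochner_Integration.integrable_bound)
      (use h in \<open>auto simp: abs_mult mult_left_le_one_le\<close>)
  have c01: "0 \<le> c" "c \<le> 1"
  proof -
    show "0 \<le> c" unfolding c_def using h by (intro integral_nonneg_AE) auto
    have "c \<le> (LBINT x. ?\<phi> x)" unfolding c_def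
      using h hi by (intro integral_mono) (auto simp: mult_left_le_one_le)
    then show "c \<le> 1" by simp
  qed
  define g where "g x = (h x - c) * ?\<phi> x" for x
  have gle: "\<bar>g x\<bar> \<le> ?\<phi> x" for x
    using h[of x] c01 by (simp add: g_def abs_mult mult_left_le_one_le abs_le_iff)
  have gi: "integrable lborel g"
    unfolding g_def left_diff_distrib using hi by (intro Bochner_Integration.integrable_diff) auto
  have gsi: "set_integrable lborel A g" if "A \<in> sets borel" for A
    using gi that unfolding set_integrable_def by (intro integrable_mult_indicator) auto
  have \<phi>c: "continuous_on UNIV ?\<phi>"
    using DERIV_std_normal_density by (intro DERIV_continuous_on) auto
  have gc: "continuous_on UNIV g"
    unfolding g_def by (intro continuous_intros hc \<phi>c)
  have g0: "(LBINT x. g x) = 0"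
    unfolding g_def left_diff_distrib using hi by (simp add: c_def)
  define H where "H x = (LBINT s:{..x}. g s)" for x
  have abs_set: "\<bar>LBINT s:A. g s\<bar> \<le> (LBINT s:A. ?\<phi> s)" if "A \<in> sets borel" for A
  proof -
    have "\<bar>LBINT s:A. g s\<bar> \<le> (LBINT s. \<bar>indicator A s *\<^sub>R g s\<bar>)"
      unfolding set_lebesgue_integral_def by (rule integral_abs_bound)
    also have "\<dots> \<le> (LBINT s. indicator A s *\<^sub>R ?\<phi> s)"
      using gsi[OF that] std_normal_set_integrable[OF that] gle
      unfolding set_integrable_def by (intro integral_mono) (auto simp: indicator_def)
    finally show ?thesis unfolding set_lebesgue_integral_def .
  qed
  \<comment> \<open>The total integral of \<open>g\<close> vanishes, so \<open>H x\<close> is controlled by the mass on either side of \<open>x\<close>.\<close>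
  have Hr: "H x = - (LBINT s:{x<..}. g s)" for x
  proof -
    have "(LBINT s. g s) = (LBINT s:{..x} \<union> {x<..}. g s)"
      by (simp add: ivl_disj_un(8) set_lebesgue_integral_def flip: Un_commute) (intro Bochner_Integration.integral_cong; auto simp: indicator_def)
    also have "\<dots> = H x + (LBINT s:{x<..}. g s)" unfolding H_def by (intro set_integral_Un gsi) auto
    finally show ?thesis using g0 by simp
  qed
  have H1: "\<bar>H x\<bar> \<le> (LBINT s:{..x}. ?\<phi> s)" for x unfolding H_def by (intro abs_set) auto
  have H2: "\<bar>H x\<bar> \<le> (LBINT s:{x..}. ?\<phi> s)" for x
  proof -
    have "\<bar>H x\<bar> \<le> (LBINT s:{x<..}. ?\<phi> s)" unfolding Hr abs_minus_cancel by (intro abs_set) auto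
    also have "\<dots> \<le> (LBINT s:{x..}. ?\<phi> s)"
      using std_normal_set_integrable[of "{x..}"] std_normal_set_integrable[of "{x<..}"]
      unfolding set_lebesgue_integral_def set_integrable_def by (intro integral_mono) (auto simp: indicator_def)
    finally show ?thesis .
  qed
  have xH: "\<bar>x\<bar> * \<bar>H x\<bar> \<le> ?\<phi> x" for x
  proof (cases "0 \<le> x")
    case True
    then show ?thesis using mills_ratio_atLeast[OF True] mult_left_mono[OF H2[of x], of x] by simp
  next
    case False
    then have "(- x) * \<bar>H x\<bar> \<le> (- x) * (LBINT s:{-x..}. ?\<phi> s)"
      using H1[of x] std_normal_reflect[of x] by (intro mult_left_mono) auto
    also have "\<dots> \<le> ?\<phi> (- x)" using False by (intro mills_ratio_atLeast) auto
    finally show ?thesis using False by (simp add: std_normal_density_def)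
  qed
  have H3: "\<bar>H x\<bar> \<le> 1" for x
  proof -
    have "\<bar>H x\<bar> \<le> (LBINT s:UNIV. ?\<phi> s)"
      using H1[of x] std_normal_set_integrable[of "{..x}"] std_normal_set_integrable[of "UNIV"]
      unfolding set_lebesgue_integral_def set_integrable_def
      by (elim order.trans, intro integral_mono) (auto simp: indicator_def)
    then show ?thesis by (simp add: set_lebesgue_integral_def)
  qed
  have \<phi>p: "0 < ?\<phi> x" for x by (simp add: normal_density_pos)
  define f where "f x = H x / ?\<phi> x" for x
  define f' where "f' x = x * f x + (h x - c)" for x
  have xf: "\<bar>x\<bar> * \<bar>f x\<bar> \<le> 1" for x using xH[of x] \<phi>p[of x] by (simp add: f_def field_simps)
  have fb: "\<bar>f x\<bar> \<le> stein_const" for x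
  proof (cases "1 \<le> \<bar>x\<bar>")
    case True
    then have "\<bar>f x\<bar> \<le> \<bar>x\<bar> * \<bar>f x\<bar>" using mult_right_mono[of 1 "\<bar>x\<bar>" "\<bar>f x\<bar>"] by simp
    also have "\<dots> \<le> stein_const" using xf[of x] \<phi>p[of 1] by (simp add: stein_const_def add_increasing2)
    finally show ?thesis .
  next
    case False
    have "?\<phi> 1 \<le> ?\<phi> x"
      using False by (simp add: std_normal_density_def divide_right_mono abs_square_le_1)
    then have "\<bar>f x\<bar> \<le> 1 / ?\<phi> 1"
      using H3[of x] \<phi>p[of x] \<phi>p[of 1] unfolding f_def abs_divide by (intro frac_le) auto
    then show ?thesis by (simp add: stein_const_def)
  qed
  have fd: "(f has_real_derivative f' x) (at x)" for x
  proof -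
    have "(H has_real_derivative g x) (at x)"
      unfolding H_def by (rule DERIV_set_integral_atMost[OF gc gi])
    from DERIV_divide[OF this DERIV_std_normal_density[of x]] \<phi>p[of x]
    have D: "((\<lambda>x. H x / ?\<phi> x) has_real_derivative (g x * ?\<phi> x - H x * (- x * ?\<phi> x)) / (?\<phi> x * ?\<phi> x)) (at x)"
      by simp
    have "(g x * ?\<phi> x - H x * (- x * ?\<phi> x)) / (?\<phi> x * ?\<phi> x) = f' x"
      using \<phi>p[of x] by (simp add: f'_def f_def g_def field_simps)
    with D show ?thesis unfolding f_def by (simp only:)
  qed
  have f'b: "\<bar>f' x\<bar> \<le> 2" for x
  proof -
    have "\<bar>x * f x\<bar> \<le> 1" using xf[of x] by (simp add: abs_mult)
    then show ?thesis using h[of x] c01 unfolding f'_def by linarith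
  qed
  have fl: "\<bar>f x - f y\<bar> \<le> 2 * \<bar>x - y\<bar>" for x y
    using field_differentiable_bound[of UNIV f f' 2 x y] fd f'b
    by (auto simp: has_field_derivative_at_within)
  have f'l: "\<bar>f' x - f' y\<bar> \<le> (stein_const + 2 * \<bar>y\<bar> + \<Lambda>) * \<bar>x - y\<bar>" for x y
  proof -
    have "f' x - f' y = (x - y) * f x + y * (f x - f y) + (h x - h y)"
      by (simp add: f'_def algebra_simps)
    then have "\<bar>f' x - f' y\<bar> \<le> \<bar>x - y\<bar> * \<bar>f x\<bar> + \<bar>y\<bar> * \<bar>f x - f y\<bar> + \<bar>h x - h y\<bar>"
      by (simp add: abs_mult[symmetric])
    also have "\<dots> \<le> \<bar>x - y\<bar> * stein_const + \<bar>y\<bar> * (2 * \<bar>x - y\<bar>) + \<Lambda> * \<bar>x - y\<bar>"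
      using fb fl lip by (intro add_mono mult_left_mono) auto
    finally show ?thesis by (simp add: algebra_simps)
  qed
  show ?thesis
    using fd fb f'b f'l by (intro exI[of _ f] exI[of _ f']) (simp add: f'_def)
qed

section \<open>Normal approximation of sign-symmetric sums\<close>

text \<open>
  A class of random variables closed under polynomial operations whose members are integrable on
  every finite measure. The coordinates of a random point of a bounded set belong to it, and so do
  bounded functions of its members.
\<close>

definition ae_bounded :: "'a measure \<Rightarrow> ('a \<Rightarrow> real) \<Rightarrow> bool"
  where "ae_bounded M g \<longleftrightarrow> g \<in> borel_measurable M \<and> (\<exists>B. AE x in M. \<bar>g x\<bar> \<le> B)"

lemma ae_boundedI: "g \<in> borel_measurable M \<Longrightarrow> (AE x in M. \<bar>g x\<bar> \<le> B) \<Longrightarrow> ae_bounded M g"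
  by (auto simp: ae_bounded_def)

lemma ae_bounded_measurable: "ae_bounded M g \<Longrightarrow> g \<in> borel_measurable M"
  by (simp add: ae_bounded_def)

lemma ae_bounded_const: "ae_bounded M (\<lambda>x. c)"
  by (rule ae_boundedI[of _ _ "\<bar>c\<bar>"]) auto

lemma ae_bounded_add:
  assumes "ae_bounded M g" "ae_bounded M h"
  shows "ae_bounded M (\<lambda>x. g x + h x)"
proof -
  obtain B C where "AE x in M. \<bar>g x\<bar> \<le> B" "AE x in M. \<bar>h x\<bar> \<le> C"
    using assms by (auto simp: ae_bounded_def)
  then have "AE x in M. \<bar>g x + h x\<bar> \<le> B + C" by eventually_elim linarith
  then show ?thesis using assms by (intro ae_boundedI) (auto simp: ae_bounded_def)
qed

lemma ae_bounded_mult: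
  assumes "ae_bounded M g" "ae_bounded M h"
  shows "ae_bounded M (\<lambda>x. g x * h x)"
proof -
  obtain B C where "AE x in M. \<bar>g x\<bar> \<le> B" "AE x in M. \<bar>h x\<bar> \<le> C"
    using assms by (auto simp: ae_bounded_def)
  then have "AE x in M. \<bar>g x * h x\<bar> \<le> B * C"
    by eventually_elim (auto simp: abs_mult intro: mult_mono order.trans[OF abs_ge_zero])
  then show ?thesis using assms by (intro ae_boundedI) (auto simp: ae_bounded_def)
qed

lemma ae_bounded_diff:
  assumes "ae_bounded M g" "ae_bounded M h"
  shows "ae_bounded M (\<lambda>x. g x - h x)"
  using ae_bounded_add[OF assms(1) ae_bounded_mult[OF ae_bounded_const[of M "-1"] assms(2)]] by simp

lemma ae_bounded_power: "ae_bounded M g \<Longrightarrow> ae_bounded M (\<lambda>x. g x ^ k)"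
  by (induction k) (auto intro: ae_bounded_mult ae_bounded_const)

lemma ae_bounded_abs: "ae_bounded M g \<Longrightarrow> ae_bounded M (\<lambda>x. \<bar>g x\<bar>)"
  by (auto simp: ae_bounded_def)

lemma ae_bounded_sum: "(\<And>i. i \<in> I \<Longrightarrow> ae_bounded M (g i)) \<Longrightarrow> ae_bounded M (\<lambda>x. \<Sum>i\<in>I. g i x)"
  by (induction I rule: infinite_finite_induct) (auto intro: ae_bounded_add ae_bounded_const)

lemma ae_bounded_compose:
  assumes "ae_bounded M g" "h \<in> borel_measurable borel" "\<And>x. \<bar>h x\<bar> \<le> B"
  shows "ae_bounded M (\<lambda>x. h (g x))"
  using assms by (intro ae_boundedI[of _ _ B]) (auto simp: ae_bounded_def)

lemmas ae_bounded_intros = ae_bounded_const ae_bounded_add ae_bounded_mult ae_bounded_diff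
  ae_bounded_power ae_bounded_abs ae_bounded_sum

lemma (in finite_measure) ae_bounded_integrable: "ae_bounded M g \<Longrightarrow> integrable M g"
  unfolding ae_bounded_def by (elim conjE exE, rule integrable_const_bound) auto

text \<open>
  The indicator of \<open>(-\<infinity>, t]\<close> smoothed linearly over an interval of length \<open>d\<close>.
\<close>

definition ramp :: "real \<Rightarrow> real \<Rightarrow> real \<Rightarrow> real"
  where "ramp t d x = max 0 (min 1 ((t + d - x) / d))"

lemma ramp_bounds: "0 \<le> ramp t d x" "ramp t d x \<le> 1"
  by (auto simp: ramp_def)

lemma ramp_lipschitz:
  assumes d: "0 < d"
  shows "\<bar>ramp t d x - ramp t d y\<bar> \<le> (1 / d) * \<bar>x - y\<bar>"
proof -
  have "\<bar>ramp t d x - ramp t d y\<bar> \<le> \<bar>(t + d - x) / d - (t + d - y) / d\<bar>"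
    unfolding ramp_def by linarith
  also have "(t + d - x) / d - (t + d - y) / d = (y - x) / d" by (simp flip: diff_divide_distrib)
  finally show ?thesis using d by (simp add: abs_minus_commute)
qed

lemma ramp_ge_indicator: "0 < d \<Longrightarrow> x \<le> t \<Longrightarrow> ramp t d x = 1"
  by (auto simp: ramp_def field_simps)

lemma ramp_zero: "0 < d \<Longrightarrow> t + d \<le> x \<Longrightarrow> ramp t d x = 0"
  by (auto simp: ramp_def field_simps)

lemma ramp_measurable [measurable]: "ramp t d \<in> borel_measurable borel"
  unfolding ramp_def by measurable

lemma integral_double_sum:
  fixes c :: "nat \<Rightarrow> nat \<Rightarrow> real"
  assumes "\<And>i j. i < n \<Longrightarrow> j < n \<Longrightarrow> integrable M (Z i j)"
  shows "(LINT x|M. (\<Sum>i<n. \<Sum>j<n. c i j * Z i j x)) = (\<Sum>i<n. \<Sum>j<n. c i j * (LINT x|M. Z i j x))"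
proof -
  have i: "integrable M (\<lambda>x. c i j * Z i j x)" if "i < n" "j < n" for i j
    using assms[OF that] by simp
  have "(LINT x|M. (\<Sum>i<n. \<Sum>j<n. c i j * Z i j x)) = (\<Sum>i<n. LINT x|M. (\<Sum>j<n. c i j * Z i j x))"
    by (rule Bochner_Integration.integral_sum) (intro Bochner_Integration.integrable_sum i; simp)
  also have "\<dots> = (\<Sum>i<n. \<Sum>j<n. LINT x|M. c i j * Z i j x)"
    by (intro sum.cong refl Bochner_Integration.integral_sum i; simp)
  finally show ?thesis by simp
qed

text \<open>
  The probabilistic content of the theorem, separated from convex geometry: a weighted sum of
  uncorrelated random variables of unit variance with bounded sixth moments and negatively correlated
  squares, whose law is invariant under flipping the sign of any one of them. The
  invariance is stated in the only form in which it is used.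
\<close>

locale symmetric_sum = prob_space M for M :: "'a measure" +
  fixes n :: nat and \<theta> :: "nat \<Rightarrow> real" and Y :: "nat \<Rightarrow> 'a \<Rightarrow> real" and W :: "'a \<Rightarrow> real" and m6 :: real
  assumes bounded: "\<And>i. i < n \<Longrightarrow> ae_bounded M (Y i)"
    and unit: "(\<Sum>i<n. (\<theta> i)\<^sup>2) = 1"
    and W_def: "W = (\<lambda>x. \<Sum>i<n. \<theta> i * Y i x)"
    and reflect: "\<And>i g B. i < n \<Longrightarrow> g \<in> borel_measurable borel \<Longrightarrow> (\<And>x. \<bar>g x\<bar> \<le> B) \<Longrightarrow>
      expectation (\<lambda>x. Y i x * g (W x)) = - expectation (\<lambda>x. Y i x * g (W x - 2 * (\<theta> i * Y i x)))"
    and isotropic: "\<And>i j. i < n \<Longrightarrow> j < n \<Longrightarrow> expectation (\<lambda>x. Y i x * Y j x) = (if i = j then 1 else 0)"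
    and neg_corr: "\<And>i j. i < n \<Longrightarrow> j < n \<Longrightarrow> i \<noteq> j \<Longrightarrow> expectation (\<lambda>x. (Y i x)\<^sup>2 * (Y j x)\<^sup>2) \<le> 1"
    and sixth: "\<And>i. i < n \<Longrightarrow> expectation (\<lambda>x. Y i x ^ 6) \<le> m6"
begin

definition "\<beta> = (\<Sum>i<n. \<bar>\<theta> i\<bar> ^ 3)"

lemma theta_le_1: "i < n \<Longrightarrow> \<bar>\<theta> i\<bar> \<le> 1"
  using member_le_sum[of i "{..<n}" "\<lambda>i. (\<theta> i)\<^sup>2"] unit by (simp add: abs_square_le_1)

lemma beta_pos: "0 < \<beta>"
proof -
  obtain i where i: "i < n" "\<theta> i \<noteq> 0" using unit by (metis (no_types, lifting) lessThan_iff power_zero_numeral sum.neutral zero_neq_one)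
  have "0 < \<bar>\<theta> i\<bar> ^ 3" using i by simp
  also have "\<dots> \<le> \<beta>" unfolding \<beta>_def using i by (intro member_le_sum) auto
  finally show ?thesis .
qed

lemma beta_le_1: "\<beta> \<le> 1"
proof -
  have "\<bar>\<theta> i\<bar> ^ 3 \<le> (\<theta> i)\<^sup>2" if "i < n" for i
    using power_decreasing[of 2 3 "\<bar>\<theta> i\<bar>"] theta_le_1[OF that] by simp
  then have "\<beta> \<le> (\<Sum>i<n. (\<theta> i)\<^sup>2)" unfolding \<beta>_def by (intro sum_mono) auto
  then show ?thesis using unit by simp
qed

lemma W_bounded: "ae_bounded M W"
  unfolding W_def by (intro ae_bounded_intros bounded) auto

lemma W_measurable [measurable]: "W \<in> borel_measurable M"
  by (rule ae_bounded_measurable[OF W_bounded])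

lemma sixth_nonneg: "0 \<le> m6"
proof -
  obtain i where i: "i < n" using unit by (cases n) auto
  have "0 \<le> expectation (\<lambda>x. Y i x ^ 6)" by (intro integral_nonneg_AE) (auto simp: zero_le_even_power)
  then show ?thesis using sixth[OF i] by linarith
qed

lemma W_second_moment: "expectation (\<lambda>x. (W x)\<^sup>2) = 1"
proof -
  have eq: "(W x)\<^sup>2 = (\<Sum>i<n. \<Sum>j<n. \<theta> i * \<theta> j * (Y i x * Y j x))" for x
    unfolding W_def power2_eq_square sum_product by (intro sum.cong) (auto simp: algebra_simps)
  then have "expectation (\<lambda>x. (W x)\<^sup>2) = (\<Sum>i<n. \<Sum>j<n. \<theta> i * \<theta> j * expectation (\<lambda>x. Y i x * Y j x))"
    unfolding eq by (intro integral_double_sum ae_bounded_integrable ae_bounded_intros bounded)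
  also have "\<dots> = (\<Sum>i<n. \<Sum>j<n. if i = j then (\<theta> i)\<^sup>2 else 0)"
    by (intro sum.cong) (auto simp: isotropic power2_eq_square)
  also have "\<dots> = 1" using unit by simp
  finally show ?thesis .
qed

text \<open>
  The inequality \<open>2 * a * b \<le> a\<^sup>2 + b\<^sup>2\<close> reduces \<open>\<bar>Y\<bar> ^ 3\<close> to \<open>1 + Y ^ 6\<close> and the product
  \<open>2 * \<bar>Y\<bar> ^ 3 * \<bar>W\<bar>\<close> to \<open>Y ^ 6 + W\<^sup>2\<close>, where \<open>W\<close> has second moment 1.
\<close>

lemma third_moment_weighted:
  assumes i: "i < n" and \<Lambda>: "0 \<le> \<Lambda>"
  shows "expectation (\<lambda>x. \<bar>Y i x\<bar> ^ 3 * (\<Lambda> + 2 * \<bar>W x\<bar>)) \<le> (1 + m6) * (\<Lambda> + 1)"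
proof -
  note b = bounded[OF i] W_bounded
  have pt: "\<bar>y\<bar> ^ 3 * (\<Lambda> + 2 * \<bar>w\<bar>) \<le> \<Lambda> * (1 + y ^ 6) + (y ^ 6 + w\<^sup>2)" for y w :: real
  proof -
    have s: "(\<bar>y\<bar> ^ 3)\<^sup>2 = y ^ 6" by (simp flip: power_mult)
    have "0 \<le> y ^ 6" by simp
    moreover have "2 * \<bar>y\<bar> ^ 3 \<le> y ^ 6 + 1"
      using sum_squares_bound[of "\<bar>y\<bar> ^ 3" 1] unfolding s by simp
    ultimately have "\<bar>y\<bar> ^ 3 \<le> 1 + y ^ 6" by linarith
    then have "\<Lambda> * \<bar>y\<bar> ^ 3 \<le> \<Lambda> * (1 + y ^ 6)" using \<Lambda> by (rule mult_left_mono)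
    moreover have "2 * \<bar>y\<bar> ^ 3 * \<bar>w\<bar> \<le> y ^ 6 + w\<^sup>2"
      using sum_squares_bound[of "\<bar>y\<bar> ^ 3" "\<bar>w\<bar>"] unfolding s by simp
    ultimately show ?thesis by (simp add: algebra_simps)
  qed
  have "expectation (\<lambda>x. \<bar>Y i x\<bar> ^ 3 * (\<Lambda> + 2 * \<bar>W x\<bar>))
      \<le> expectation (\<lambda>x. \<Lambda> * (1 + Y i x ^ 6) + (Y i x ^ 6 + (W x)\<^sup>2))"
    by (intro integral_mono pt ae_bounded_integrable ae_bounded_intros b)
  also have "\<dots> = \<Lambda> * (1 + expectation (\<lambda>x. Y i x ^ 6)) + (expectation (\<lambda>x. Y i x ^ 6) + 1)"
    by (simp add: ae_bounded_integrable ae_bounded_intros b W_second_moment prob_space)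
  also have "\<dots> \<le> \<Lambda> * (1 + m6) + (m6 + 1)"
    using sixth[OF i] \<Lambda> by (intro add_mono mult_left_mono) auto
  finally show ?thesis by (simp add: algebra_simps)
qed

text \<open>
  For independent signs this is the conditional variance of the sum given the absolute values of
  its terms. The distance of \<open>V\<close> from 1 is what separates the sum from a Gaussian beyond Taylor remainders.
\<close>

definition "V x = (\<Sum>i<n. (\<theta> i * Y i x)\<^sup>2)"

lemma V_bounded: "ae_bounded M V"
  unfolding V_def by (intro ae_bounded_intros bounded) auto

text \<open>
  In the double sum for the variance, negative correlation makes all off-diagonal terms
  nonpositive. The diagonal contributes \<open>\<theta> i ^ 4\<close>, at most \<open>\<bar>\<theta> i\<bar> ^ 3\<close>, times a fourth moment.
\<close>

lemma V_variance: "expectation (\<lambda>x. (1 - V x)\<^sup>2) \<le> (1 + m6) * \<beta>"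
proof -
  define Z where "Z i x = (Y i x)\<^sup>2 - 1" for i x
  have Zb: "ae_bounded M (Z i)" if "i < n" for i
    unfolding Z_def by (intro ae_bounded_intros bounded that)
  have y2: "expectation (\<lambda>x. (Y i x)\<^sup>2) = 1" if "i < n" for i
    using isotropic[OF that that] by (simp add: power2_eq_square)
  have ZZ: "expectation (\<lambda>x. Z i x * Z j x) = expectation (\<lambda>x. (Y i x)\<^sup>2 * (Y j x)\<^sup>2) - 1"
    if i: "i < n" and j: "j < n" for i j
  proof -
    have "expectation (\<lambda>x. Z i x * Z j x) = expectation (\<lambda>x. (Y i x)\<^sup>2 * (Y j x)\<^sup>2 - (Y i x)\<^sup>2 - (Y j x)\<^sup>2 + 1)"
      by (intro Bochner_Integration.integral_cong) (auto simp: Z_def algebra_simps)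
    also have "\<dots> = expectation (\<lambda>x. (Y i x)\<^sup>2 * (Y j x)\<^sup>2) - 1"
      by (simp add: ae_bounded_integrable ae_bounded_intros bounded i j y2 prob_space)
    finally show ?thesis .
  qed
  have diag: "expectation (\<lambda>x. Z i x * Z i x) \<le> 1 + m6" if i: "i < n" for i
  proof -
    have "y\<^sup>2 * y\<^sup>2 \<le> 1 + y ^ 6" for y :: real
    proof (cases "\<bar>y\<bar> \<le> 1")
      case True
      then have "\<bar>y\<bar> ^ 4 \<le> 1" by (intro power_le_one) auto
      moreover have "0 \<le> y ^ 6" "y\<^sup>2 * y\<^sup>2 = \<bar>y\<bar> ^ 4" by (simp_all flip: power_add)
      ultimately show ?thesis by linarith
    next
      case False
      then have "\<bar>y\<bar> ^ 4 \<le> \<bar>y\<bar> ^ 6" by (intro power_increasing) auto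
      then show ?thesis by (simp flip: power_add)
    qed
    then have "expectation (\<lambda>x. (Y i x)\<^sup>2 * (Y i x)\<^sup>2) \<le> expectation (\<lambda>x. 1 + Y i x ^ 6)"
      by (intro integral_mono ae_bounded_integrable ae_bounded_intros bounded i)
    also have "\<dots> = 1 + expectation (\<lambda>x. Y i x ^ 6)"
      by (simp add: ae_bounded_integrable ae_bounded_intros bounded i prob_space)
    finally show ?thesis using sixth[OF i] ZZ[OF i i] by linarith
  qed
  have eq: "(1 - V x)\<^sup>2 = (\<Sum>i<n. \<Sum>j<n. (\<theta> i)\<^sup>2 * (\<theta> j)\<^sup>2 * (Z i x * Z j x))" for x
  proof -
    have "V x - 1 = (\<Sum>i<n. (\<theta> i)\<^sup>2 * Z i x)"
      unfolding V_def Z_def using unit by (simp add: power_mult_distrib right_diff_distrib sum_subtractf)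
    then have "(V x - 1)\<^sup>2 = (\<Sum>i<n. \<Sum>j<n. (\<theta> i)\<^sup>2 * (\<theta> j)\<^sup>2 * (Z i x * Z j x))"
      unfolding power2_eq_square[of "V x - 1"] by (simp add: sum_product algebra_simps)
    then show ?thesis by (simp add: power2_commute)
  qed
  have "expectation (\<lambda>x. (1 - V x)\<^sup>2) = (\<Sum>i<n. \<Sum>j<n. (\<theta> i)\<^sup>2 * (\<theta> j)\<^sup>2 * expectation (\<lambda>x. Z i x * Z j x))"
    unfolding eq by (intro integral_double_sum ae_bounded_integrable ae_bounded_intros Zb)
  also have "\<dots> \<le> (\<Sum>i<n. \<Sum>j<n. if i = j then \<bar>\<theta> i\<bar> ^ 3 * (1 + m6) else 0)"
  proof (intro sum_mono)
    fix i j assume "i \<in> {..<n}" "j \<in> {..<n}"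
    then have i: "i < n" and j: "j < n" by auto
    show "(\<theta> i)\<^sup>2 * (\<theta> j)\<^sup>2 * expectation (\<lambda>x. Z i x * Z j x) \<le> (if i = j then \<bar>\<theta> i\<bar> ^ 3 * (1 + m6) else 0)"
    proof (cases "i = j")
      case True
      have "(\<theta> i)\<^sup>2 * (\<theta> i)\<^sup>2 = \<bar>\<theta> i\<bar> ^ 4" by (simp flip: power_add)
      also have "\<dots> \<le> \<bar>\<theta> i\<bar> ^ 3" using theta_le_1[OF i] by (intro power_decreasing) auto
      finally have "(\<theta> i)\<^sup>2 * (\<theta> i)\<^sup>2 * expectation (\<lambda>x. Z i x * Z i x) \<le> \<bar>\<theta> i\<bar> ^ 3 * (1 + m6)"
        using diag[OF i] by (intro mult_mono) (auto intro!: integral_nonneg_AE)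
      then show ?thesis using True by simp
    next
      case False
      then show ?thesis using neg_corr[OF i j] ZZ[OF i j] by (simp add: mult_nonneg_nonpos)
    qed
  qed
  also have "\<dots> = (1 + m6) * \<beta>" by (simp add: \<beta>_def sum_distrib_left mult.commute)
  finally show ?thesis .
qed

text \<open>
  The inequality \<open>\<bar>v\<bar> \<le> (e + v\<^sup>2 / e) / 2\<close> passes from second to first moments; as the variance is of
  order \<open>\<beta>\<close>, the choice \<open>e = sqrt \<beta>\<close> makes both terms of order \<open>sqrt \<beta>\<close>.
\<close>

lemma V_deviation: "expectation (\<lambda>x. \<bar>1 - V x\<bar>) \<le> (2 + m6) / 2 * sqrt \<beta>"
proof -
  define e where "e = sqrt \<beta>"
  have e: "0 < e" "e * e = \<beta>" using beta_pos by (auto simp: e_def)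
  have pt: "\<bar>v\<bar> \<le> (e + v\<^sup>2 / e) / 2" for v
    using sum_squares_bound[of e "\<bar>v\<bar>"] e by (simp add: field_simps power2_eq_square)
  have "expectation (\<lambda>x. \<bar>1 - V x\<bar>) \<le> expectation (\<lambda>x. (e + (1 - V x)\<^sup>2 / e) / 2)"
    unfolding divide_inverse[of _ e] divide_inverse[of _ 2]
    by (intro integral_mono pt[unfolded divide_inverse] ae_bounded_integrable ae_bounded_intros V_bounded)
  also have "\<dots> = (e + expectation (\<lambda>x. (1 - V x)\<^sup>2) / e) / 2"
    by (simp add: ae_bounded_integrable ae_bounded_intros V_bounded prob_space)
  also have "\<dots> \<le> (e + (1 + m6) * (e * e) / e) / 2"
    using V_variance e by (intro divide_right_mono add_left_mono) auto
  also have "\<dots> = (2 + m6) / 2 * e" using e(1) by (simp add: field_simps)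
  finally show ?thesis by (simp add: e_def)
qed

text \<open>
  With \<open>a i = \<theta> i * Y i\<close>, averaging over the sign flip of the \<open>i\<close>-th term replaces \<open>a i * f (W)\<close> by
  \<open>a i * (f (W) - f (W - 2 * a i)) / 2\<close>, which equals \<open>(a i)\<^sup>2 * f' (W)\<close> up to the Taylor remainder
  \<open>D i\<close>, of third order in \<open>a i\<close>. Summing over \<open>i\<close> turns \<open>W * f (W)\<close> into \<open>V * f' (W)\<close>, and
  \<open>V\<close> is close to 1.
\<close>

lemma stein_discrepancy:
  fixes f f' :: "real \<Rightarrow> real"
  assumes d: "\<And>x. (f has_real_derivative f' x) (at x)"
    and fb: "\<And>x. \<bar>f x\<bar> \<le> C" and f'b: "\<And>x. \<bar>f' x\<bar> \<le> 2"
    and f'l: "\<And>x y. \<bar>f' x - f' y\<bar> \<le> (\<Lambda> + 2 * \<bar>y\<bar>) * \<bar>x - y\<bar>"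
    and \<Lambda>: "0 \<le> \<Lambda>"
  shows "\<bar>expectation (\<lambda>x. f' (W x) - W x * f (W x))\<bar> \<le> (2 + m6) * sqrt \<beta> + 2 * (1 + m6) * (\<Lambda> + 1) * \<beta>"
proof -
  have fm [measurable]: "f \<in> borel_measurable borel"
    using d by (intro borel_measurable_continuous_onI DERIV_continuous_on[of UNIV f f']) auto
  have f'm [measurable]: "f' \<in> borel_measurable borel"
  proof -
    have "continuous (at y) f'" for y
    proof -
      have "((\<lambda>x. (\<Lambda> + 2 * \<bar>y\<bar>) * \<bar>x - y\<bar>) \<longlongrightarrow> (\<Lambda> + 2 * \<bar>y\<bar>) * \<bar>y - y\<bar>) (at y)" by (intro tendsto_intros)
      then have "((\<lambda>x. f' x - f' y) \<longlongrightarrow> 0) (at y)"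
        by (intro Lim_null_comparison[of "\<lambda>x. f' x - f' y" "\<lambda>x. (\<Lambda> + 2 * \<bar>y\<bar>) * \<bar>x - y\<bar>"])
          (auto intro!: always_eventually f'l)
      then show ?thesis unfolding continuous_at by (simp add: LIM_zero_iff)
    qed
    then show ?thesis by (intro borel_measurable_continuous_onI) (simp add: continuous_on_eq_continuous_at)
  qed
  define a where "a i x = \<theta> i * Y i x" for i x
  have ab: "ae_bounded M (a i)" if "i < n" for i
    unfolding a_def by (intro ae_bounded_intros bounded that)
  have fW: "ae_bounded M (\<lambda>x. f (W x))" "ae_bounded M (\<lambda>x. f' (W x))"
    using ae_bounded_compose[OF W_bounded fm fb] ae_bounded_compose[OF W_bounded f'm f'b] by auto
  have fWa: "ae_bounded M (\<lambda>x. f (W x - 2 * a i x))" if "i < n" for i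
    using that fb by (intro ae_bounded_compose[where h = f] ae_bounded_intros W_bounded ab) auto
  note bi = ae_bounded_integrable ae_bounded_intros ab fW fWa W_bounded V_bounded
  define D where "D i x = a i x * (f (W x) - f (W x - 2 * a i x)) / 2 - (a i x)\<^sup>2 * f' (W x)" for i x
  have Db: "ae_bounded M (D i)" if "i < n" for i
    unfolding D_def divide_inverse by (intro bi that)
  have sym: "expectation (\<lambda>x. a i x * f (W x)) = expectation (\<lambda>x. a i x * (f (W x) - f (W x - 2 * a i x)) / 2)"
    if i: "i < n" for i
  proof -
    have "expectation (\<lambda>x. a i x * f (W x)) = - expectation (\<lambda>x. a i x * f (W x - 2 * a i x))"
      using reflect[OF i fm fb] by (simp add: a_def mult.assoc)
    moreover have "expectation (\<lambda>x. a i x * (f (W x) - f (W x - 2 * a i x)) / 2)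
       = (expectation (\<lambda>x. a i x * f (W x)) - expectation (\<lambda>x. a i x * f (W x - 2 * a i x))) / 2"
    proof -
      have "integrable M (\<lambda>x. a i x * f (W x))" "integrable M (\<lambda>x. a i x * f (W x - 2 * a i x))"
        by (intro bi i)+
      then show ?thesis by (simp add: right_diff_distrib)
    qed
    ultimately show ?thesis by simp
  qed
  have Dle: "\<bar>D i x\<bar> \<le> 2 * \<bar>\<theta> i\<bar> ^ 3 * (\<bar>Y i x\<bar> ^ 3 * (\<Lambda> + 2 * \<bar>W x\<bar>))" for i x
  proof -
    let ?w = "W x" and ?a = "a i x"
    \<comment> \<open>The remainder of the linearization at \<open>W x\<close>; its derivative is small near \<open>W x\<close>.\<close>
    define r where "r z = f z - z * f' ?w" for z
    have "norm (r ?w - r (?w - 2 * ?a)) \<le> ((\<Lambda> + 2 * \<bar>?w\<bar>) * (2 * \<bar>?a\<bar>)) * norm (?w - (?w - 2 * ?a))"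
    proof (rule field_differentiable_bound[of "cball ?w (2 * \<bar>?a\<bar>)"])
      fix z assume z: "z \<in> cball ?w (2 * \<bar>?a\<bar>)"
      show "(r has_real_derivative (f' z - f' ?w)) (at z within cball ?w (2 * \<bar>?a\<bar>))"
        unfolding r_def by (rule has_field_derivative_at_within) (auto intro!: derivative_eq_intros d)
      have "\<bar>z - ?w\<bar> \<le> 2 * \<bar>?a\<bar>" using z by (simp add: dist_real_def abs_minus_commute)
      then have "(\<Lambda> + 2 * \<bar>?w\<bar>) * \<bar>z - ?w\<bar> \<le> (\<Lambda> + 2 * \<bar>?w\<bar>) * (2 * \<bar>?a\<bar>)"
        using \<Lambda> by (intro mult_left_mono) auto
      then show "norm (f' z - f' ?w) \<le> (\<Lambda> + 2 * \<bar>?w\<bar>) * (2 * \<bar>?a\<bar>)"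
        using f'l[of z ?w] by simp
    qed (auto simp: dist_real_def)
    then have "\<bar>f ?w - f (?w - 2 * ?a) - 2 * ?a * f' ?w\<bar> \<le> (\<Lambda> + 2 * \<bar>?w\<bar>) * (2 * \<bar>?a\<bar>) * (2 * \<bar>?a\<bar>)"
      by (simp add: r_def algebra_simps abs_mult)
    then have "\<bar>?a\<bar> * \<bar>f ?w - f (?w - 2 * ?a) - 2 * ?a * f' ?w\<bar> / 2 \<le> \<bar>?a\<bar> * ((\<Lambda> + 2 * \<bar>?w\<bar>) * (2 * \<bar>?a\<bar>) * (2 * \<bar>?a\<bar>)) / 2"
      by (intro divide_right_mono mult_left_mono) auto
    also have "\<bar>?a\<bar> * \<bar>f ?w - f (?w - 2 * ?a) - 2 * ?a * f' ?w\<bar> / 2 = \<bar>D i x\<bar>"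
    proof -
      have eq: "D i x = ?a * (f ?w - f (?w - 2 * ?a) - 2 * ?a * f' ?w) / 2"
        by (simp add: D_def field_simps power2_eq_square)
      show ?thesis unfolding eq abs_divide abs_mult by simp
    qed
    also have "\<bar>?a\<bar> * ((\<Lambda> + 2 * \<bar>?w\<bar>) * (2 * \<bar>?a\<bar>) * (2 * \<bar>?a\<bar>)) / 2 = 2 * \<bar>?a\<bar> ^ 3 * (\<Lambda> + 2 * \<bar>?w\<bar>)"
      by (simp add: power3_eq_cube)
    also have "\<bar>?a\<bar> ^ 3 = \<bar>\<theta> i\<bar> ^ 3 * \<bar>Y i x\<bar> ^ 3" by (simp add: a_def abs_mult power_mult_distrib)
    finally show ?thesis by (simp only: mult.assoc)
  qed
  have "expectation (\<lambda>x. W x * f (W x)) = (\<Sum>i<n. expectation (\<lambda>x. a i x * f (W x)))"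
  proof -
    have Wa: "W x = (\<Sum>i<n. a i x)" for x by (simp add: W_def a_def)
    have "expectation (\<lambda>x. W x * f (W x)) = expectation (\<lambda>x. \<Sum>i<n. a i x * f (W x))"
      unfolding sum_distrib_right[symmetric] Wa[symmetric] ..
    also have "\<dots> = (\<Sum>i<n. expectation (\<lambda>x. a i x * f (W x)))"
      by (intro Bochner_Integration.integral_sum bi) auto
    finally show ?thesis .
  qed
  also have "\<dots> = (\<Sum>i<n. expectation (\<lambda>x. a i x * (f (W x) - f (W x - 2 * a i x)) / 2))"
    by (intro sum.cong sym) auto
  also have "\<dots> = (\<Sum>i<n. expectation (\<lambda>x. D i x + (a i x)\<^sup>2 * f' (W x)))"
    by (simp add: D_def)
  also have "\<dots> = (\<Sum>i<n. expectation (D i)) + expectation (\<lambda>x. V x * f' (W x))"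
  proof -
    have Va: "V x = (\<Sum>i<n. (a i x)\<^sup>2)" for x by (simp add: V_def a_def)
    have "expectation (\<lambda>x. V x * f' (W x)) = expectation (\<lambda>x. \<Sum>i<n. (a i x)\<^sup>2 * f' (W x))"
      unfolding sum_distrib_right[symmetric] Va[symmetric] ..
    also have "\<dots> = (\<Sum>i<n. expectation (\<lambda>x. (a i x)\<^sup>2 * f' (W x)))"
      by (intro Bochner_Integration.integral_sum bi) auto
    finally have v: "expectation (\<lambda>x. V x * f' (W x)) = (\<Sum>i<n. expectation (\<lambda>x. (a i x)\<^sup>2 * f' (W x)))" .
    show ?thesis unfolding v sum.distrib[symmetric]
      by (intro sum.cong refl Bochner_Integration.integral_add bi Db) auto
  qed
  finally have Wf: "expectation (\<lambda>x. W x * f (W x)) = (\<Sum>i<n. expectation (D i)) + expectation (\<lambda>x. V x * f' (W x))" .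
  have "integrable M (\<lambda>x. f' (W x))" "integrable M (\<lambda>x. W x * f (W x))" "integrable M (\<lambda>x. V x * f' (W x))"
    by (intro bi)+
  then have main: "expectation (\<lambda>x. f' (W x) - W x * f (W x))
      = expectation (\<lambda>x. (1 - V x) * f' (W x)) - (\<Sum>i<n. expectation (D i))"
    using Wf by (simp add: left_diff_distrib)
  have "\<bar>expectation (\<lambda>x. (1 - V x) * f' (W x))\<bar> \<le> expectation (\<lambda>x. \<bar>(1 - V x) * f' (W x)\<bar>)"
    by (rule integral_abs_bound)
  also have "\<dots> \<le> expectation (\<lambda>x. \<bar>1 - V x\<bar> * 2)"
    using f'b by (intro integral_mono bi) (auto simp: abs_mult intro: mult_left_mono)
  also have "\<dots> \<le> (2 + m6) * sqrt \<beta>" using V_deviation by simp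
  finally have p1: "\<bar>expectation (\<lambda>x. (1 - V x) * f' (W x))\<bar> \<le> (2 + m6) * sqrt \<beta>" .
  have "\<bar>expectation (D i)\<bar> \<le> 2 * \<bar>\<theta> i\<bar> ^ 3 * ((1 + m6) * (\<Lambda> + 1))" if i: "i < n" for i
  proof -
    have "\<bar>expectation (D i)\<bar> \<le> expectation (\<lambda>x. \<bar>D i x\<bar>)" by (rule integral_abs_bound)
    also have "\<dots> \<le> expectation (\<lambda>x. 2 * \<bar>\<theta> i\<bar> ^ 3 * (\<bar>Y i x\<bar> ^ 3 * (\<Lambda> + 2 * \<bar>W x\<bar>)))"
      by (intro integral_mono Dle bi Db bounded i)
    also have "\<dots> = 2 * \<bar>\<theta> i\<bar> ^ 3 * expectation (\<lambda>x. \<bar>Y i x\<bar> ^ 3 * (\<Lambda> + 2 * \<bar>W x\<bar>))" by simp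
    also have "\<dots> \<le> 2 * \<bar>\<theta> i\<bar> ^ 3 * ((1 + m6) * (\<Lambda> + 1))"
      by (intro mult_left_mono third_moment_weighted i \<Lambda>) auto
    finally show ?thesis .
  qed
  then have "\<bar>\<Sum>i<n. expectation (D i)\<bar> \<le> (\<Sum>i<n. 2 * \<bar>\<theta> i\<bar> ^ 3 * ((1 + m6) * (\<Lambda> + 1)))"
    by (intro order.trans[OF sum_abs] sum_mono) auto
  also have "\<dots> = 2 * (1 + m6) * (\<Lambda> + 1) * \<beta>"
    unfolding \<beta>_def sum_distrib_left by (intro sum.cong) (auto simp: algebra_simps)
  finally show ?thesis using main p1 by linarith
qed

lemma ramp_integrable: "integrable M (\<lambda>x. ramp t d (W x))"
proof -
  have "\<bar>ramp t d x\<bar> \<le> 1" for x using ramp_bounds[of t d x] by simp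
  then show ?thesis by (intro ae_bounded_integrable ae_bounded_compose[OF W_bounded ramp_measurable])
qed

text \<open>
  A ramp of width \<open>d\<close> is \<open>1 / d\<close>-Lipschitz, so it costs \<open>\<beta> / d\<close> in Stein's bound, while smoothing
  the indicator costs \<open>d\<close>. The choice \<open>d = sqrt \<beta>\<close> balances both; the remaining terms of order
  \<open>\<beta>\<close> are absorbed because \<open>\<beta> \<le> 1\<close>.
\<close>

lemma smooth_test_function_bound:
  assumes d: "d = sqrt \<beta>"
  shows "\<bar>expectation (\<lambda>x. ramp t d (W x)) - (LBINT s. ramp t d s * std_normal_density s)\<bar>
    \<le> ((2 + m6) + 2 * (1 + m6) * (stein_const + 2)) * sqrt \<beta>"
proof -
  have dp: "0 < d" using beta_pos d by simp
  define c where "c = (LBINT s. ramp t d s * std_normal_density s)"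
  obtain f f' where ff: "\<And>x. (f has_real_derivative f' x) (at x)" "\<And>x. f' x - x * f x = ramp t d x - c"
      "\<And>x. \<bar>f x\<bar> \<le> stein_const" "\<And>x. \<bar>f' x\<bar> \<le> 2"
      "\<And>x y. \<bar>f' x - f' y\<bar> \<le> (stein_const + 2 * \<bar>y\<bar> + 1 / d) * \<bar>x - y\<bar>"
    using stein_solution_exists[of "ramp t d" "1 / d"] ramp_bounds ramp_lipschitz[OF dp]
    unfolding c_def[symmetric] by metis
  have s0: "0 \<le> stein_const" by (simp add: stein_const_def)
  have "\<bar>expectation (\<lambda>x. f' (W x) - W x * f (W x))\<bar>
      \<le> (2 + m6) * sqrt \<beta> + 2 * (1 + m6) * ((stein_const + 1 / d) + 1) * \<beta>"
    using ff s0 dp by (intro stein_discrepancy[of f f' stein_const]) (auto simp: add_ac)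
  also have "(\<lambda>x. f' (W x) - W x * f (W x)) = (\<lambda>x. ramp t d (W x) - c)" using ff(2) by simp
  also have "expectation (\<lambda>x. ramp t d (W x) - c) = expectation (\<lambda>x. ramp t d (W x)) - c"
    by (simp add: prob_space ramp_integrable)
  also have "2 * (1 + m6) * ((stein_const + 1 / d) + 1) * \<beta> \<le> 2 * (1 + m6) * ((stein_const + 2) * sqrt \<beta>)"
  proof -
    have "\<beta> \<le> d" using beta_pos beta_le_1 real_le_rsqrt[of \<beta> \<beta>] unfolding d
      by (simp add: power2_eq_square mult_left_le_one_le)
    moreover have "1 / d * \<beta> = d" using beta_pos dp d by (simp add: field_simps)
    ultimately have "(stein_const + 1 / d + 1) * \<beta> \<le> (stein_const + 2) * d"
      using mult_left_mono[of \<beta> d "stein_const + 1"] s0 by (simp add: algebra_simps)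
    then show ?thesis using sixth_nonneg d by (simp add: mult_left_mono mult.assoc)
  qed
  finally show ?thesis unfolding c_def by (simp add: algebra_simps)
qed

lemma normal_cdf_increment:
  assumes "0 \<le> d"
  shows "(LBINT s:{..t + d}. std_normal_density s) \<le> (LBINT s:{..t}. std_normal_density s) + d"
proof -
  have "{..t + d} = {..t} \<union> {t<..t + d}" using assms by auto
  moreover have "(LBINT s:{..t} \<union> {t<..t + d}. std_normal_density s)
     = (LBINT s:{..t}. std_normal_density s) + (LBINT s:{t<..t + d}. std_normal_density s)"
    by (intro set_integral_Un std_normal_set_integrable) auto
  moreover have "(LBINT s:{t<..t + d}. std_normal_density s) \<le> (LBINT s:{t<..t + d}. 1)"
  proof (intro set_integral_mono std_normal_set_integrable)
    have "1 \<le> sqrt (2 * pi)" using pi_ge_two by (intro real_le_rsqrt) auto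
    then have "1 / sqrt (2 * pi) \<le> 1" by simp
    then show "std_normal_density s \<le> 1" for s
      using std_normal_density_le[of s] by linarith
  qed (use assms in \<open>auto simp: set_integrable_def intro!: integrable_real_indicator\<close>)
  moreover have "(LBINT s:{t<..t + d}. 1) = d" using assms by (simp add: set_integral_const)
  ultimately show ?thesis by simp
qed

text \<open>
  The indicator of \<open>(-\<infinity>, t]\<close> lies between the ramps that start their descent at \<open>t - d\<close> and at
  \<open>t\<close>, where \<open>d = sqrt \<beta>\<close>, and the Gaussian distribution function changes by at most \<open>d\<close> over an interval of length \<open>d\<close>.
\<close>

lemma kolmogorov_bound:
  "\<bar>prob {x \<in> space M. W x \<le> t} - (LBINT s:{..t}. std_normal_density s)\<bar>
    \<le> ((3 + m6) + 2 * (1 + m6) * (stein_const + 2)) * sqrt \<beta>"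
proof -
  define d where "d = sqrt \<beta>"
  define k where "k = ((2 + m6) + 2 * (1 + m6) * (stein_const + 2)) * sqrt \<beta>"
  have dp: "0 < d" using beta_pos d_def by simp
  let ?P = "\<lambda>t. prob {x \<in> space M. W x \<le> t}" and ?N = "\<lambda>t. LBINT s:{..t}. std_normal_density s"
  have ni: "integrable lborel (\<lambda>s. ramp t d s * std_normal_density s)" for t
  proof -
    have "integrable lborel std_normal_density" by simp
    then show ?thesis
      by (rule Bochner_Integration.integrable_bound)
        (use ramp_bounds in \<open>auto simp: abs_mult mult_left_le_one_le\<close>)
  qed
  have ii: "integrable M (indicator {x \<in> space M. W x \<le> t} :: 'a \<Rightarrow> real)" for t
    by (rule integrable_real_indicator) (auto simp: less_top[symmetric])
  have Pe: "?P t = expectation (indicator {x \<in> space M. W x \<le> t})" for t by simp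
  have up: "?P t \<le> expectation (\<lambda>x. ramp t d (W x))" for t
    unfolding Pe using ramp_integrable ii ramp_bounds ramp_ge_indicator[OF dp]
    by (intro integral_mono) (auto simp: indicator_def)
  have lo: "expectation (\<lambda>x. ramp (t - d) d (W x)) \<le> ?P t" for t
    unfolding Pe using ramp_integrable ii ramp_bounds ramp_zero[OF dp, of "t - d"]
    by (intro integral_mono) (auto simp: indicator_def)
  have nup: "(LBINT s. ramp t d s * std_normal_density s) \<le> ?N (t + d)" for t
    unfolding set_lebesgue_integral_def
    using ni ramp_bounds ramp_zero[OF dp, of t] std_normal_set_integrable[of "{..t + d}"]
    by (intro integral_mono) (auto simp: indicator_def set_integrable_def mult_left_le_one_le)
  have nlo: "?N t \<le> (LBINT s. ramp t d s * std_normal_density s)" for t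
    unfolding set_lebesgue_integral_def
    using ni ramp_bounds ramp_ge_indicator[OF dp, of _ t] std_normal_set_integrable[of "{..t}"]
    by (intro integral_mono) (auto simp: indicator_def set_integrable_def)
  have S: "\<bar>expectation (\<lambda>x. ramp t d (W x)) - (LBINT s. ramp t d s * std_normal_density s)\<bar> \<le> k" for t
    unfolding k_def by (rule smooth_test_function_bound[OF d_def])
  have "?P t \<le> ?N t + d + k"
    using up[of t] S[of t] nup[of t] normal_cdf_increment[of d t] dp by linarith
  moreover have "?N t - d - k \<le> ?P t"
    using lo[of t] S[of "t - d"] nlo[of "t - d"] normal_cdf_increment[of d "t - d"] dp by simp
  ultimately have "\<bar>?P t - ?N t\<bar> \<le> k + d" by linarith
  also have "k + d = ((3 + m6) + 2 * (1 + m6) * (stein_const + 2)) * sqrt \<beta>"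
    by (simp add: k_def d_def algebra_simps)
  finally show ?thesis .
qed

end

section \<open>Isotropic Orlicz balls\<close>

locale isotropic_orlicz_ball =
  fixes n :: nat and f :: "nat \<Rightarrow> real \<Rightarrow> real" and K :: "(nat \<Rightarrow> real) set" and L :: real
  assumes young: "\<And>i. i < n \<Longrightarrow> young_function (f i)"
    and K_def: "K = orlicz_sublevel {..<n} f 1"
    and isotropic: "isotropic_position n K L"
begin

abbreviation "P \<equiv> (\<Pi>\<^sub>M i\<in>{..<n}. lborel) :: (nat \<Rightarrow> real) measure"
abbreviation "M \<equiv> uniform_on n K"

lemma M_def: "M = uniform_measure P K"
  by (simp add: uniform_on_def euclidean_lborel_def)

lemma K_sets [measurable]: "K \<in> sets P"
  unfolding K_def using young by (intro sets_orlicz_sublevel) auto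

lemma K_volume: "emeasure P K = 1"
  using isotropic by (simp add: isotropic_position_def euclidean_lborel_def)

lemma L_pos: "0 < L"
  using isotropic by (simp add: isotropic_position_def)

lemma sets_M [measurable_cong, simp]: "sets M = sets P"
  by (simp add: M_def)

lemma space_M [simp]: "space M = space P"
  by (simp add: M_def)

sublocale prob_space M
  unfolding M_def by (rule prob_space_uniform_measure) (simp_all add: K_volume)

lemma nn_integral_M:
  assumes "g \<in> borel_measurable P"
  shows "(\<integral>\<^sup>+ x. g x \<partial>M) = (\<integral>\<^sup>+ x. g x * indicator K x \<partial>P)"
  unfolding M_def using assms by (subst nn_integral_uniform_measure) (simp_all add: K_volume divide_ennreal_def)

lemma coordinate_measurable [measurable]: "i < n \<Longrightarrow> (\<lambda>x. x i) \<in> borel_measurable P"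
  using measurable_component_singleton[of i "{..<n}" "\<lambda>_. lborel"] by simp

lemma coordinate_bounded:
  assumes i: "i < n"
  shows "ae_bounded M (\<lambda>x. x i)"
proof (rule ae_boundedI)
  have "\<bar>x i\<bar> \<le> max 1 (1 / f i 1)" if x: "x \<in> K" for x
  proof -
    have "f i \<bar>x i\<bar> \<le> (\<Sum>j<n. f j \<bar>x j\<bar>)"
      using i by (intro member_le_sum) (auto simp: young_nonneg[OF young])
    also have "\<dots> \<le> 1" using x by (simp add: K_def orlicz_sublevel_def)
    finally show ?thesis by (intro young_bound young i) auto
  qed
  then show "AE x in M. \<bar>x i\<bar> \<le> max 1 (1 / f i 1)"
    unfolding M_def by (intro AE_uniform_measureI) auto
qed (use i in simp)

lemma coordinate_moment: "i < n \<Longrightarrow> integrable M (\<lambda>x. x i ^ k)"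
  by (intro ae_bounded_integrable ae_bounded_power coordinate_bounded)

lemma expectation_product: "i < n \<Longrightarrow> j < n \<Longrightarrow> expectation (\<lambda>x. x i * x j) = (if i = j then L\<^sup>2 else 0)"
  using isotropic by (simp add: isotropic_position_def)

lemma second_moment: "i < n \<Longrightarrow> expectation (\<lambda>x. (x i)\<^sup>2) = L\<^sup>2"
  using expectation_product[of i i] by (simp add: power2_eq_square)

lemma nn_second_moment:
  assumes i: "i < n"
  shows "(\<integral>\<^sup>+ x. ennreal ((x i)\<^sup>2) \<partial>M) = ennreal (L\<^sup>2)"
  using coordinate_moment[OF i, of 2] second_moment[OF i]
  by (subst nn_integral_eq_integral) auto

text \<open>
  The inequality between unnormalized integrals specializes to moments because \<open>K\<close> has volume 1.
\<close>

lemma square_negative_correlation: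
  assumes ij: "i < n" "j < n" "i \<noteq> j"
  shows "expectation (\<lambda>x. (x i)\<^sup>2 * (x j)\<^sup>2) \<le> L ^ 4"
proof -
  define I where "I = {..<n} - {i, j}"
  have ins: "insert i (insert j I) = {..<n}" using ij by (auto simp: I_def)
  have N: "(\<integral>\<^sup>+ x. ennreal (\<phi> (x i) (x j)) * indicator (orlicz_sublevel (insert i (insert j I)) f 1) x \<partial>(\<Pi>\<^sub>M i\<in>insert i (insert j I). lborel))
      = (\<integral>\<^sup>+ x. ennreal (\<phi> (x i) (x j)) \<partial>M)"
    if [measurable]: "case_prod \<phi> \<in> borel_measurable (borel \<Otimes>\<^sub>M borel)" for \<phi>
  proof -
    have "(\<lambda>x. ennreal (\<phi> (x i) (x j))) \<in> borel_measurable P" using ij by measurable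
    then show ?thesis unfolding ins K_def[symmetric] by (simp add: nn_integral_M)
  qed
  have "(\<integral>\<^sup>+ x. ennreal ((x i)\<^sup>2 * (x j)\<^sup>2) \<partial>M) * (\<integral>\<^sup>+ x. ennreal 1 \<partial>M)
      \<le> (\<integral>\<^sup>+ x. ennreal ((x i)\<^sup>2) \<partial>M) * (\<integral>\<^sup>+ x. ennreal ((x j)\<^sup>2) \<partial>M)"
  proof -
    have I: "finite I" "i \<notin> I" "j \<notin> I" by (auto simp: I_def)
    have fI: "\<And>k. k \<in> insert i (insert j I) \<Longrightarrow> young_function (f k)" unfolding ins using young by simp
    note N4 = N[of "\<lambda>y z. y\<^sup>2 * z\<^sup>2"] N[of "\<lambda>y z. 1"] N[of "\<lambda>y z. y\<^sup>2"] N[of "\<lambda>y z. z\<^sup>2"]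
    show ?thesis
      using orlicz_square_negative_correlation[where f = f and s = 1, OF I ij(3) fI] N4 by simp
  qed
  also have "\<dots> = ennreal (L ^ 4)"
    using ij by (simp add: nn_second_moment flip: ennreal_mult' power_add)
  finally have le: "(\<integral>\<^sup>+ x. ennreal ((x i)\<^sup>2 * (x j)\<^sup>2) \<partial>M) \<le> ennreal (L ^ 4)"
    by (simp add: emeasure_space_1[simplified])
  have "integrable M (\<lambda>x. (x i)\<^sup>2 * (x j)\<^sup>2)"
    using ij by (intro ae_bounded_integrable ae_bounded_intros coordinate_bounded)
  then have "(\<integral>\<^sup>+ x. ennreal ((x i)\<^sup>2 * (x j)\<^sup>2) \<partial>M) = ennreal (expectation (\<lambda>x. (x i)\<^sup>2 * (x j)\<^sup>2))"
    by (intro nn_integral_eq_integral) auto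
  with le show ?thesis by simp
qed

text \<open>
  Markov's inequality bounds the tail of \<open>\<bar>x i\<bar>\<close> at \<open>2 * L\<close> by \<open>1 / 4\<close>; log-concavity makes it
  decay at least like \<open>(1 / 4) ^ k\<close> along the multiples of \<open>2 * L\<close>. The factor 64 is \<open>2 ^ 6\<close>.
\<close>

lemma sixth_moment:
  assumes i: "i < n"
  shows "expectation (\<lambda>x. (x i / L) ^ 6) \<le> 64 * sixth_moment_bound"
proof -
  define I where "I = {..<n} - {i}"
  have ins: "insert i I = {..<n}" and I: "finite I" "i \<notin> I" using i by (auto simp: I_def)
  have fI: "\<And>j. j \<in> insert i I \<Longrightarrow> young_function (f j)" unfolding ins using young by simp
  note [measurable] = coordinate_measurable[OF i]
  define T where "T = orlicz_tail i I f 1"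
  have T: "(\<integral>\<^sup>+ x. indicator {y. t < \<bar>y\<bar>} (x i) \<partial>M) = ennreal (T t)" if "0 \<le> t" for t
  proof -
    have "(\<lambda>x. indicator {y. t < \<bar>y\<bar>} (x i) :: ennreal) \<in> borel_measurable P" by measurable
    then show ?thesis using emeasure_orlicz_tail[where f = f, OF I fI that, of 1] 
      unfolding ins T_def K_def[symmetric] by (simp add: nn_integral_M)
  qed
  have Tset: "emeasure M {x \<in> space M. t < \<bar>x i\<bar>} = ennreal (T t)" if "0 \<le> t" for t
  proof -
    have "{x \<in> space M. t < \<bar>x i\<bar>} \<in> sets M" by measurable
    then have "emeasure M {x \<in> space M. t < \<bar>x i\<bar>} = (\<integral>\<^sup>+ x. indicator {x \<in> space M. t < \<bar>x i\<bar>} x \<partial>M)" by simp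
    also have "\<dots> = (\<integral>\<^sup>+ x. indicator {y. t < \<bar>y\<bar>} (x i) \<partial>M)"
      by (rule nn_integral_cong) (simp add: indicator_def)
    finally show ?thesis using T[OF that] by simp
  qed
  have "ennreal (T 0) = ennreal (orlicz_volume {..<n} f 1)"
    using orlicz_volume_insert[where f = f, OF I fI, of 1] unfolding ins T_def by simp
  also have "\<dots> = emeasure P K"
    unfolding K_def by (intro emeasure_orlicz_sublevel[symmetric] young) auto
  finally have "ennreal (T 0) = 1" by (simp add: K_volume)
  then have T0: "T 0 = 1" by (simp add: ennreal_eq_1)
  have "ennreal (T (2 * L)) = (\<integral>\<^sup>+ x. indicator {y. 2 * L < \<bar>y\<bar>} (x i) \<partial>M)"
    using T[of "2 * L"] L_pos by simp
  also have "\<dots> \<le> (\<integral>\<^sup>+ x. ennreal (1 / (4 * L\<^sup>2)) * ennreal ((x i)\<^sup>2) \<partial>M)"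
  proof (intro nn_integral_mono)
    fix x :: "nat \<Rightarrow> real"
    show "indicator {y. 2 * L < \<bar>y\<bar>} (x i) \<le> ennreal (1 / (4 * L\<^sup>2)) * ennreal ((x i)\<^sup>2)"
    proof (cases "2 * L < \<bar>x i\<bar>")
      case True
      then have "(2 * L)\<^sup>2 \<le> \<bar>x i\<bar>\<^sup>2" using L_pos by (intro power_mono) auto
      then have "1 \<le> 1 / (4 * L\<^sup>2) * (x i)\<^sup>2" using L_pos by (simp add: field_simps)
      then show ?thesis using True by (simp flip: ennreal_mult')
    qed simp
  qed
  also have "\<dots> = ennreal (1 / (4 * L\<^sup>2)) * ennreal (L\<^sup>2)"
    using nn_second_moment[OF i] by (subst nn_integral_cmult) auto
  also have "\<dots> = ennreal (1 / 4)" using L_pos by (simp flip: ennreal_mult')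
  finally have q: "T (2 * L) \<le> 1 / 4" by simp
  have "(\<integral>\<^sup>+ x. ennreal ((\<bar>x i\<bar> / (2 * L)) ^ 6) \<partial>M) \<le> ennreal sixth_moment_bound"
  proof (rule sixth_moment_from_tail)
    fix k :: nat
    have "{x \<in> space M. real k < \<bar>x i\<bar> / (2 * L)} = {x \<in> space M. real k * (2 * L) < \<bar>x i\<bar>}"
      using L_pos by (auto simp: field_simps)
    then have "emeasure M {x \<in> space M. real k < \<bar>x i\<bar> / (2 * L)} = ennreal (T (real k * (2 * L)))"
      using Tset[of "real k * (2 * L)"] L_pos by simp
    also have "\<dots> \<le> ennreal ((1 / 4) ^ k)"
      using orlicz_tail_geometric[where f = f and s = 1 and t = "2 * L" and q = "1 / 4" and k = k, OF I(1) fI] T0 q L_pos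
      unfolding T_def by (intro ennreal_leI) auto
    finally show "emeasure M {x \<in> space M. real k < \<bar>x i\<bar> / (2 * L)} \<le> ennreal ((1 / 4) ^ k)" .
  qed (use L_pos in auto)
  moreover have "(\<integral>\<^sup>+ x. ennreal ((\<bar>x i\<bar> / (2 * L)) ^ 6) \<partial>M) = ennreal (expectation (\<lambda>x. (\<bar>x i\<bar> / (2 * L)) ^ 6))"
    using coordinate_bounded[OF i] L_pos unfolding divide_inverse
    by (intro nn_integral_eq_integral ae_bounded_integrable ae_bounded_intros) auto
  ultimately have "expectation (\<lambda>x. (\<bar>x i\<bar> / (2 * L)) ^ 6) \<le> sixth_moment_bound"
    using sixth_moment_bound_nonneg by simp
  moreover have "(\<lambda>x :: nat \<Rightarrow> real. (\<bar>x i\<bar> / (2 * L)) ^ 6) = (\<lambda>x. (x i / L) ^ 6 / 64)"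
    by (simp add: power_divide power_mult_distrib mult.commute)
  ultimately show ?thesis by simp
qed

definition "reflection i x = x(i := - x i)" for i :: nat and x :: "nat \<Rightarrow> real"

lemma reflection_measurable [measurable]:
  assumes "i < n" shows "reflection i \<in> measurable P P"
proof -
  have "(\<lambda>x. x(i := - x i)) \<in> measurable P P"
    using assms by (intro measurable_fun_upd[where J = "{..<n}"]) (auto intro: measurable_ident)
  then show ?thesis by (simp add: reflection_def[abs_def])
qed

lemma nn_integral_reflection:
  assumes i: "i < n" and g: "g \<in> borel_measurable P"
  shows "(\<integral>\<^sup>+ x. g (reflection i x) \<partial>P) = (\<integral>\<^sup>+ x. g x \<partial>P)"
proof -
  define I where "I = {..<n} - {i}"
  have ins: "insert i I = {..<n}" and I: "finite I" "i \<notin> I" using i by (auto simp: I_def)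
  note split = lborels.product_nn_integral_insert[OF I, unfolded ins]
  have "(\<integral>\<^sup>+ x. g (reflection i x) \<partial>P)
      = (\<integral>\<^sup>+ x. \<integral>\<^sup>+ y. g (reflection i (x(i := y))) \<partial>lborel \<partial>(\<Pi>\<^sub>M i\<in>I. lborel))"
    by (rule split[OF measurable_compose[OF reflection_measurable[OF i] g]])
  also have "\<dots> = (\<integral>\<^sup>+ x. \<integral>\<^sup>+ y. g (x(i := y)) \<partial>lborel \<partial>(\<Pi>\<^sub>M i\<in>I. lborel))"
  proof (rule nn_integral_cong)
    fix x assume x: "x \<in> space (\<Pi>\<^sub>M i\<in>I. lborel :: real measure)"
    have "(\<lambda>y. x(i := y)) \<in> measurable lborel P"
      using x unfolding ins[symmetric] by (intro measurable_fun_upd[where J = I]) auto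
    from measurable_compose[OF this g]
    have "(\<integral>\<^sup>+ y. g (x(i := y)) \<partial>lborel) = (\<integral>\<^sup>+ y. g (x(i := - y)) \<partial>lborel)"
      by (subst nn_integral_real_affine[where c = "-1" and t = 0]) simp_all
    then show "(\<integral>\<^sup>+ y. g (reflection i (x(i := y))) \<partial>lborel) = (\<integral>\<^sup>+ y. g (x(i := y)) \<partial>lborel)"
      by (simp add: reflection_def)
  qed
  also have "\<dots> = (\<integral>\<^sup>+ x. g x \<partial>P)" by (rule split[OF g, symmetric])
  finally show ?thesis .
qed

lemma distr_reflection:
  assumes i: "i < n"
  shows "distr M M (reflection i) = M"
proof (rule measure_eqI)
  fix A assume "A \<in> sets (distr M M (reflection i))"
  then have A [measurable]: "A \<in> sets P" by simp
  have m: "reflection i \<in> measurable M M" using reflection_measurable[OF i] by (simp cong: measurable_cong_sets)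
  have Kr: "indicator K (reflection i x) = (indicator K x :: ennreal)" if "x \<in> space P" for x
  proof -
    have "reflection i x \<in> space P" using reflection_measurable[OF i] that by (rule measurable_space)
    moreover have "(\<Sum>j<n. f j \<bar>reflection i x j\<bar>) = (\<Sum>j<n. f j \<bar>x j\<bar>)"
      by (intro sum.cong) (auto simp: reflection_def)
    ultimately show ?thesis using that by (simp add: K_def orlicz_sublevel_def indicator_def)
  qed
  have "emeasure (distr M M (reflection i)) A = (\<integral>\<^sup>+ x. indicator A x \<partial>distr M M (reflection i))" by simp
  also have "\<dots> = (\<integral>\<^sup>+ x. indicator A (reflection i x) \<partial>M)"
    using m by (subst nn_integral_distr) auto
  also have "\<dots> = (\<integral>\<^sup>+ x. indicator A (reflection i x) * indicator K x \<partial>P)"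
    using i by (intro nn_integral_M) measurable
  also have "\<dots> = (\<integral>\<^sup>+ x. (\<lambda>x. indicator A x * indicator K x) (reflection i x) \<partial>P)"
    by (intro nn_integral_cong) (simp add: Kr)
  also have "\<dots> = (\<integral>\<^sup>+ x. indicator A x * indicator K x \<partial>P)"
    using i by (intro nn_integral_reflection) auto
  also have "\<dots> = (\<integral>\<^sup>+ x. indicator A x \<partial>M)" by (intro nn_integral_M[symmetric]) measurable
  also have "\<dots> = emeasure M A" by simp
  finally show "emeasure (distr M M (reflection i)) A = emeasure M A" .
qed simp

lemma expectation_reflection:
  fixes g :: "(nat \<Rightarrow> real) \<Rightarrow> real"
  assumes i: "i < n" and g: "g \<in> borel_measurable P"
  shows "expectation (\<lambda>x. g (reflection i x)) = expectation g"
proof -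
  have "expectation g = (LINT x|distr M M (reflection i). g x)" by (simp add: distr_reflection[OF i])
  also have "\<dots> = expectation (\<lambda>x. g (reflection i x))"
    using g reflection_measurable[OF i]
    by (intro integral_distr) (simp_all cong: measurable_cong_sets)
  finally show ?thesis by simp
qed

lemma linear_form_measurable [measurable]: "(\<lambda>x. inner_n n x \<theta>) \<in> borel_measurable P"
  unfolding inner_n_def by measurable

lemma symmetric_sum:
  assumes \<theta>: "\<theta> \<in> unit_sphere_n n"
  shows "symmetric_sum M n \<theta> (\<lambda>i x. x i / L) (\<lambda>x. inner_n n x \<theta> / L) (64 * sixth_moment_bound)"
proof unfold_locales
  show "ae_bounded M (\<lambda>x. x i / L)" if "i < n" for i
    unfolding divide_inverse using that by (intro ae_bounded_intros coordinate_bounded)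
  show "(\<Sum>i<n. (\<theta> i)\<^sup>2) = 1"
    using \<theta> by (simp add: unit_sphere_n_def inner_n_def power2_eq_square)
  show "(\<lambda>x. inner_n n x \<theta> / L) = (\<lambda>x. \<Sum>i<n. \<theta> i * (x i / L))"
    by (simp add: inner_n_def sum_divide_distrib mult.commute)
  show "expectation (\<lambda>x. x i / L * g (inner_n n x \<theta> / L))
      = - expectation (\<lambda>x. x i / L * g (inner_n n x \<theta> / L - 2 * (\<theta> i * (x i / L))))"
    if i: "i < n" and [measurable]: "g \<in> borel_measurable borel" for i g and B :: real
  proof -
    have "inner_n n (reflection i x) \<theta> = inner_n n x \<theta> - 2 * (\<theta> i * x i)" for x
    proof -
      have "inner_n n (reflection i x) \<theta> = (\<Sum>j<n. x j * \<theta> j - (if j = i then 2 * (\<theta> i * x i) else 0))"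
        unfolding inner_n_def reflection_def by (intro sum.cong) auto
      then show ?thesis using i by (simp add: sum_subtractf inner_n_def)
    qed
    then have "(\<lambda>x. (\<lambda>x. x i / L * g (inner_n n x \<theta> / L)) (reflection i x))
        = (\<lambda>x. - (x i / L * g (inner_n n x \<theta> / L - 2 * (\<theta> i * (x i / L)))))"
      by (simp add: reflection_def diff_divide_distrib)
    moreover have "expectation (\<lambda>x. (\<lambda>x. x i / L * g (inner_n n x \<theta> / L)) (reflection i x))
        = expectation (\<lambda>x. x i / L * g (inner_n n x \<theta> / L))"
      using i by (intro expectation_reflection) measurable
    ultimately show ?thesis by simp
  qed
  show "expectation (\<lambda>x. x i / L * (x j / L)) = (if i = j then 1 else 0)" if "i < n" "j < n" for i j
    using expectation_product[OF that] L_pos by (simp add: power2_eq_square split: if_splits)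
  show "expectation (\<lambda>x. (x i / L)\<^sup>2 * (x j / L)\<^sup>2) \<le> 1" if "i < n" "j < n" "i \<noteq> j" for i j
  proof -
    have "expectation (\<lambda>x. (x i / L)\<^sup>2 * (x j / L)\<^sup>2) = expectation (\<lambda>x. (x i)\<^sup>2 * (x j)\<^sup>2) / L ^ 4"
      by (simp add: power_divide flip: power_add)
    then show ?thesis using square_negative_correlation[OF that] L_pos by simp
  qed
  show "expectation (\<lambda>x. (x i / L) ^ 6) \<le> 64 * sixth_moment_bound" if "i < n" for i
    by (rule sixth_moment[OF that])
qed

text \<open>
  Along a coordinate in which \<open>\<theta>\<close> does not vanish, the linear form is an invertible affine function,
  under which the preimage of a Lebesgue null set is a null set. Fubini extends this to the
  product measure.
\<close>

lemma absolutely_continuous_linear_form: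
  assumes i: "i < n" "\<theta> i \<noteq> 0"
  shows "absolutely_continuous lborel (distr M lborel (\<lambda>x. inner_n n x \<theta>))"
  unfolding absolutely_continuous_def
proof
  fix N :: "real set" assume N: "N \<in> null_sets lborel"
  then have [measurable]: "N \<in> sets borel" by auto
  define I where "I = {..<n} - {i}"
  have ins: "insert i I = {..<n}" and I: "finite I" "i \<notin> I" using i by (auto simp: I_def)
  have "emeasure (distr M lborel (\<lambda>x. inner_n n x \<theta>)) N
      = (\<integral>\<^sup>+ s. indicator N s \<partial>distr M lborel (\<lambda>x. inner_n n x \<theta>))" by simp
  also have "\<dots> = (\<integral>\<^sup>+ x. indicator N (inner_n n x \<theta>) \<partial>M)"
    by (intro nn_integral_distr) simp_all
  also have "\<dots> = (\<integral>\<^sup>+ x. indicator N (inner_n n x \<theta>) * indicator K x \<partial>P)"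
    by (intro nn_integral_M) measurable
  also have "\<dots> \<le> (\<integral>\<^sup>+ x. indicator N (inner_n n x \<theta>) \<partial>P)"
    by (intro nn_integral_mono) (auto simp: indicator_def)
  also have "\<dots> = (\<integral>\<^sup>+ x. \<integral>\<^sup>+ y. indicator N (inner_n n (x(i := y)) \<theta>) \<partial>lborel \<partial>(\<Pi>\<^sub>M i\<in>I. lborel))"
    using lborels.product_nn_integral_insert[OF I, of "\<lambda>x. indicator N (inner_n n x \<theta>)"]
    unfolding ins by simp
  also have "\<dots> = (\<integral>\<^sup>+ x. 0 \<partial>(\<Pi>\<^sub>M i\<in>I. lborel :: real measure))"
  proof (rule nn_integral_cong)
    fix x :: "nat \<Rightarrow> real"
    define t where "t = (\<Sum>j\<in>I. x j * \<theta> j)"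
    have "inner_n n (x(i := y)) \<theta> = t + \<theta> i * y" for y
      unfolding inner_n_def t_def using I by (subst ins[symmetric]) (auto intro!: sum.cong simp: mult.commute)
    moreover have "0 = \<bar>\<theta> i\<bar> * (\<integral>\<^sup>+ y. indicator N (t + \<theta> i * y) \<partial>lborel)"
      using N i(2) by (subst nn_integral_real_affine[symmetric]) auto
    ultimately show "(\<integral>\<^sup>+ y. indicator N (inner_n n (x(i := y)) \<theta>) \<partial>lborel) = 0"
      using i(2) by simp
  qed
  finally show "N \<in> null_sets (distr M lborel (\<lambda>x. inner_n n x \<theta>))" by (simp add: null_sets_def)
qed

lemma marginal_density_exists:
  assumes \<theta>: "\<theta> \<in> unit_sphere_n n"
  shows "\<exists>g. is_marginal_density n K \<theta> g"
proof -
  have "\<not> (\<forall>i<n. \<theta> i = 0)"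
  proof
    assume "\<forall>i<n. \<theta> i = 0"
    then have "inner_n n \<theta> \<theta> = 0" by (simp add: inner_n_def)
    then show False using \<theta> by (simp add: unit_sphere_n_def)
  qed
  then obtain i where i: "i < n" "\<theta> i \<noteq> 0" by auto
  let ?D = "distr M lborel (\<lambda>x. inner_n n x \<theta>)"
  have fin: "finite_measure ?D" by (intro finite_measure_distr) simp
  have ac: "absolutely_continuous lborel ?D" by (rule absolutely_continuous_linear_form[where i = i and \<theta> = \<theta>, OF i])
  obtain g where g: "g \<in> borel_measurable lborel" "AE x in lborel. RN_deriv lborel ?D x = ennreal (g x)" "\<And>x. 0 \<le> g x"
    using sigma_finite_measure.real_RN_deriv[OF sigma_finite_lborel fin ac] by auto
  have "?D = density lborel (RN_deriv lborel ?D)"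
    by (rule sigma_finite_measure.density_RN_deriv[OF sigma_finite_lborel ac, symmetric]) simp
  also have "\<dots> = density lborel (\<lambda>x. ennreal (g x))"
    using g by (intro density_cong) auto
  finally show ?thesis
    using g by (intro exI[of _ g]) (auto simp: is_marginal_density_def distributed_def)
qed

lemma marginal_density_cdf:
  assumes g: "is_marginal_density n K \<theta> g"
  shows "set_integrable lborel {..t} g"
    "(LBINT s:{..t}. g s) = prob {x \<in> space M. inner_n n x \<theta> \<le> t}"
proof -
  have g0: "\<And>s. 0 \<le> g s" and D: "distributed M lborel (\<lambda>x. inner_n n x \<theta>) (\<lambda>s. ennreal (g s))"
    using g by (auto simp: is_marginal_density_def)
  have "(\<lambda>s. enn2real (ennreal (g s))) \<in> borel_measurable lborel"
    using distributed_borel_measurable[OF D] by measurable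
  then have [measurable]: "g \<in> borel_measurable borel" using g0 by simp
  have "ennreal (prob {x \<in> space M. inner_n n x \<theta> \<le> t})
      = emeasure M ((\<lambda>x. inner_n n x \<theta>) -` {..t} \<inter> space M)"
    by (simp add: emeasure_eq_measure vimage_def Int_def conj_commute)
  also have "\<dots> = (\<integral>\<^sup>+ s. ennreal (g s) * indicator {..t} s \<partial>lborel)"
    by (rule distributed_emeasure[OF D]) simp
  also have "\<dots> = (\<integral>\<^sup>+ s. ennreal (indicator {..t} s *\<^sub>R g s) \<partial>lborel)"
    by (intro nn_integral_cong) (auto simp: indicator_def)
  finally have e: "(\<integral>\<^sup>+ s. ennreal (indicator {..t} s *\<^sub>R g s) \<partial>lborel) = ennreal (prob {x \<in> space M. inner_n n x \<theta> \<le> t})" ..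
  have "has_bochner_integral lborel (\<lambda>s. indicator {..t} s *\<^sub>R g s) (prob {x \<in> space M. inner_n n x \<theta> \<le> t})"
    using e g0 by (intro has_bochner_integral_nn_integral) auto
  then show "set_integrable lborel {..t} g" "(LBINT s:{..t}. g s) = prob {x \<in> space M. inner_n n x \<theta> \<le> t}"
    by (auto simp: set_integrable_def set_lebesgue_integral_def has_bochner_integral_iff)
qed

lemma normal_cdf_scale:
  "(LBINT s:{..t}. normal_density 0 L s) = (LBINT s:{..t / L}. std_normal_density s)"
proof -
  have "L * (indicator {..t} (L * s) * normal_density 0 L (L * s)) = indicator {..t / L} s * std_normal_density s" for s
    using L_pos by (auto simp: normal_density_def indicator_def field_simps real_sqrt_mult)
  then show ?thesis
    unfolding set_lebesgue_integral_def using L_pos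
    by (subst lborel_integral_real_affine[where c = L and t = 0]) (simp_all flip: integral_mult_right_zero)
qed

end

theorem corollary4p3:
  "\<exists>c::real. \<forall>n\<ge>1. \<forall>(K :: (nat \<Rightarrow> real) set) (L :: real) (\<theta> :: nat \<Rightarrow> real).
     generalized_orlicz_ball n K \<longrightarrow> isotropic_position n K L \<longrightarrow> \<theta> \<in> unit_sphere_n n \<longrightarrow>
       (\<exists>g\<theta>. is_marginal_density n K \<theta> g\<theta>) \<and>
       (\<forall>g\<theta>. is_marginal_density n K \<theta> g\<theta> \<longrightarrow>
         (SUP t::real. ereal \<bar>LINT s:{..t}|lborel. (g\<theta> s - normal_density 0 L s)\<bar>)
           \<le> ereal (c * norm3_n n \<theta> powr (3 / 2)))"
proof -
  define m6 where "m6 = 64 * sixth_moment_bound"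
  define c where "c = (3 + m6) + 2 * (1 + m6) * (stein_const + 2)"
  have "(\<exists>g\<theta>. is_marginal_density n K \<theta> g\<theta>) \<and>
       (\<forall>g\<theta>. is_marginal_density n K \<theta> g\<theta> \<longrightarrow>
         (SUP t::real. ereal \<bar>LINT s:{..t}|lborel. (g\<theta> s - normal_density 0 L s)\<bar>)
           \<le> ereal (c * norm3_n n \<theta> powr (3 / 2)))"
    if K: "generalized_orlicz_ball n K" and iso: "isotropic_position n K L" and \<theta>: "\<theta> \<in> unit_sphere_n n"
    for n K L \<theta>
  proof (intro conjI allI impI)
    obtain f where f: "\<And>i. i < n \<Longrightarrow> young_function (f i)" "K = orlicz_sublevel {..<n} f 1"
      using K unfolding generalized_orlicz_ball_def orlicz_sublevel_def euclidean_lborel_def by auto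
    interpret isotropic_orlicz_ball n f K L using f iso by unfold_locales auto
    interpret S: symmetric_sum "uniform_on n K" n \<theta> "\<lambda>i x. x i / L" "\<lambda>x. inner_n n x \<theta> / L" m6
      unfolding m6_def by (rule symmetric_sum[OF \<theta>])
    show "\<exists>g\<theta>. is_marginal_density n K \<theta> g\<theta>" by (rule marginal_density_exists[OF \<theta>])
    fix g assume g: "is_marginal_density n K \<theta> g"
    have \<beta>: "norm3_n n \<theta> powr (3 / 2) = sqrt S.\<beta>"
      using S.beta_pos by (simp add: norm3_n_def S.\<beta>_def powr_powr powr_half_sqrt sum_nonneg)
    have "\<bar>LINT s:{..t}|lborel. (g s - normal_density 0 L s)\<bar> \<le> c * norm3_n n \<theta> powr (3 / 2)" for t
    proof -
      have "set_integrable lborel {..t} (normal_density 0 L)"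
        using L_pos unfolding set_integrable_def by (intro integrable_mult_indicator) auto
      then have "(LINT s:{..t}|lborel. (g s - normal_density 0 L s))
          = prob {x \<in> space M. inner_n n x \<theta> \<le> t} - (LBINT s:{..t / L}. std_normal_density s)"
        using marginal_density_cdf[OF g, of t] by (simp add: set_integral_diff normal_cdf_scale)
      also have "{x \<in> space M. inner_n n x \<theta> \<le> t} = {x \<in> space M. inner_n n x \<theta> / L \<le> t / L}"
        using L_pos by (simp add: divide_le_cancel)
      finally show ?thesis using S.kolmogorov_bound[of "t / L"] unfolding \<beta> c_def by simp
    qed
    then show "(SUP t::real. ereal \<bar>LINT s:{..t}|lborel. (g s - normal_density 0 L s)\<bar>)
        \<le> ereal (c * norm3_n n \<theta> powr (3 / 2))"
      by (intro SUP_least) simp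
  qed
  then show ?thesis by (intro exI[of _ c]) blast
qed

end
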